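(* Let $\mathcal{A}$ be the $2$-dimensional associative algebra over $\mathbb{C}$ with basis $\{e_1,e_2\}$ and multiplication $e_1e_1=e_1$, $e_1e_2=e_2e_1=e_2$, $e_2e_2=e_2$ (so $e_1$ is the unit). There exist, up to isomorphism, two $2$-dimensional weak Hopf algebras over $\mathbb{C}$. They have underlying algebra $\mathcal{A}$ and are given by: (1) $\Delta(e_1)=e_1\otimes e_1$, $\Delta(e_2)=(e_1-e_2)\otimes(e_1-e_2)+e_2\otimes e_2$, $\varepsilon(e_1)=1$, $\varepsilon(e_2)=1$, $S(e_1)=e_1$, $S(e_2)=e_2$; (2) $\Delta(e_1)=(e_1-e_2)\otimes(e_1-e_2)+e_2\otimes e_2$, $\Delta(e_2)=e_2\otimes e_2$, $\varepsilon(e_1)=2$, $\varepsilon(e_2)=1$, $S(e_1)=e_1$, $S(e_2)=e_2$.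
   Context: Weak bialgebra (here $\mathbb{K}=\mathbb{C}$). Write $xy=m(x\otimes y)$ and use Sweedler notation $\Delta(x)=x_{(1)}\otimes x_{(2)}$ (summation understood). A weak bialgebra is a quintuple $(V,m,\eta,\Delta,\varepsilon)$ with linear maps $m:V\otimes V\to V$, $\eta:\mathbb{K}\to V$ (write $1=\eta(1)$), $\Delta:V\to V\otimes V$, $\varepsilon:V\to\mathbb{K}$ such that: (1) $(V,m,\eta)$ is a unital associative algebra; (2) $(V,\Delta,\varepsilon)$ is a coassociative counital coalgebra; (3) for all $x,y,z\in V$: $\Delta(xy)=\Delta(x)\bullet\Delta(y)$; $(\Delta\otimes \mathrm{id})\Delta(1)=(\Delta(1)\otimes 1)\bullet(1\otimes\Delta(1))=(1\otimes\Delta(1))\bullet(\Delta(1)\otimes 1)$; and $\varepsilon(xyz)=\varepsilon(xy_{(1)})\,\varepsilon(y_{(2)}z)$. Here $\bullet$ is the usual componentwise multiplication on tensor powers of $V$. Weak Hopf algebra: a weak bialgebra together with a linear endomorphism $S$ of $V$ (antipode) such that for all $x\in V$: $m(\mathrm{id}\otimes S)\Delta(x)=(\varepsilon\otimes \mathrm{id})(\Delta(1)\bullet(x\otimes 1))$; $m(S\otimes \mathrm{id})\Delta(x)=(\mathrm{id}\otimes\varepsilon)((1\otimes x)\bullet\Delta(1))$; $m(m\otimes \mathrm{id})(S\otimes \mathrm{id}\otimes S)(\Delta\otimes \mathrm{id})\Delta(x)=S(x)$. Two weak Hopf algebras are isomorphic if there is a linear bijection between them compatible with multiplications, comultiplications,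 counits and antipodes. *)

theory Defs
  imports "HOL-Analysis.Analysis" "HOL-Library.Poly_Mapping"
begin

section \<open>Complex vector spaces\<close>

class complex_vector = ab_group_add +
  fixes scaleC :: "complex \<Rightarrow> 'a \<Rightarrow> 'a"  (infixr "*\<^sub>C" 75)
  assumes scaleC_add_right: "a *\<^sub>C (x + y) = a *\<^sub>C x + a *\<^sub>C y"
    and scaleC_add_left: "(a + b) *\<^sub>C x = a *\<^sub>C x + b *\<^sub>C x"
    and scaleC_scaleC: "a *\<^sub>C (b *\<^sub>C x) = (a * b) *\<^sub>C x"
    and scaleC_one: "1 *\<^sub>C x = x"

global_interpretation complex_vector: vector_space "scaleC :: complex \<Rightarrow> 'a \<Rightarrow> 'a::complex_vector"
  by unfold_locales (rule scaleC_add_right scaleC_add_left scaleC_scaleC scaleC_one)+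

abbreviation clinear :: "('a::complex_vector \<Rightarrow> 'b::complex_vector) \<Rightarrow> bool" where
  "clinear \<equiv> Vector_Spaces.linear scaleC scaleC"

definition cbilinear ::
    "('a::complex_vector \<Rightarrow> 'b::complex_vector \<Rightarrow> 'c::complex_vector) \<Rightarrow> bool" where
  "cbilinear B \<longleftrightarrow> (\<forall>y. clinear (\<lambda>x. B x y)) \<and> (\<forall>x. clinear (\<lambda>y. B x y))"

lemma clinear_iff:
  "clinear f \<longleftrightarrow> (\<forall>x y. f (x + y) = f x + f y) \<and> (\<forall>c x. f (c *\<^sub>C x) = c *\<^sub>C f x)"
  by (auto simp: Vector_Spaces.linear_iff complex_vector.vector_space_axioms)

lemma clinearI:
  assumes "\<And>x y. f (x + y) = f x + f y" "\<And>c x. f (c *\<^sub>C x) = c *\<^sub>C f x"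
  shows "clinear f"
  using assms by (simp add: clinear_iff)

instantiation complex :: complex_vector
begin
definition scaleC_complex :: "complex \<Rightarrow> complex \<Rightarrow> complex" where
  "scaleC_complex = (*)"
instance by standard (auto simp: scaleC_complex_def algebra_simps)
end

instantiation vec :: (complex_vector, finite) complex_vector
begin
definition scaleC_vec :: "complex \<Rightarrow> 'a^'b \<Rightarrow> 'a^'b" where
  "scaleC_vec c x = (\<chi> i. c *\<^sub>C (x $ i))"
instance
  by standard (auto simp: scaleC_vec_def vec_eq_iff complex_vector.scale_right_distrib
      complex_vector.scale_left_distrib)
end

instantiation poly_mapping :: (type, complex_vector) complex_vector
begin
definition scaleC_poly_mapping :: "complex \<Rightarrow> ('a \<Rightarrow>\<^sub>0 'b) \<Rightarrow> ('a \<Rightarrow>\<^sub>0 'b)" where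
  "scaleC_poly_mapping c f = Poly_Mapping.map (scaleC c) f"

lemma lookup_scaleC: "Poly_Mapping.lookup (c *\<^sub>C f) k = c *\<^sub>C Poly_Mapping.lookup f k"
  by (simp add: scaleC_poly_mapping_def Poly_Mapping.map.rep_eq when_def)

instance
  by standard (auto intro!: poly_mapping_eqI simp: lookup_scaleC lookup_add
      complex_vector.scale_right_distrib complex_vector.scale_left_distrib)
end


section \<open>The tensor product over the complex numbers\<close>

text \<open>
  The free complex vector space on the product of the two spaces, modulo the subspace
  spanned by the bilinearity relations.
\<close>

definition tensor_relators ::
    "(('a::complex_vector \<times> 'b::complex_vector) \<Rightarrow>\<^sub>0 complex) set" where
  "tensor_relators =
     {Poly_Mapping.single (x + x', y) 1 - Poly_Mapping.single (x, y) 1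
        - Poly_Mapping.single (x', y) 1 | x x' y. True}
   \<union> {Poly_Mapping.single (x, y + y') 1 - Poly_Mapping.single (x, y) 1
        - Poly_Mapping.single (x, y') 1 | x y y'. True}
   \<union> {Poly_Mapping.single (c *\<^sub>C x, y) 1 - c *\<^sub>C Poly_Mapping.single (x, y) 1 | c x y. True}
   \<union> {Poly_Mapping.single (x, c *\<^sub>C y) 1 - c *\<^sub>C Poly_Mapping.single (x, y) 1 | c x y. True}"

definition tensor_rel ::
    "(('a::complex_vector \<times> 'b::complex_vector) \<Rightarrow>\<^sub>0 complex) \<Rightarrow> (('a \<times> 'b) \<Rightarrow>\<^sub>0 complex) \<Rightarrow> bool"
  where "tensor_rel f g \<longleftrightarrow> f - g \<in> complex_vector.span tensor_relators"

lemma tensor_rel_equivp: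
  "equivp (tensor_rel ::
     (('a::complex_vector \<times> 'b::complex_vector) \<Rightarrow>\<^sub>0 complex) \<Rightarrow> _)"
  (is "equivp ?R")
proof (rule equivpI)
  show "reflp ?R"
    by (simp add: reflp_def tensor_rel_def complex_vector.span_zero)
  show "symp ?R"
    unfolding symp_def tensor_rel_def by (metis complex_vector.span_neg minus_diff_eq)
  show "transp ?R"
  proof (rule transpI)
    fix f g h :: "('a \<times> 'b) \<Rightarrow>\<^sub>0 complex"
    assume "tensor_rel f g" "tensor_rel g h"
    then have "(f - g) + (g - h) \<in> complex_vector.span tensor_relators"
      unfolding tensor_rel_def by (rule complex_vector.span_add)
    then show "tensor_rel f h" by (simp add: tensor_rel_def)
  qed
qed

quotient_type (overloaded) ('a, 'b) tensor =
    "(('a::complex_vector \<times> 'b::complex_vector) \<Rightarrow>\<^sub>0 complex)" / tensor_rel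
  by (rule tensor_rel_equivp)

instantiation tensor :: (complex_vector, complex_vector) complex_vector
begin

lift_definition zero_tensor :: "('a, 'b) tensor" is 0 .

lift_definition plus_tensor :: "('a, 'b) tensor \<Rightarrow> ('a, 'b) tensor \<Rightarrow> ('a, 'b) tensor" is "(+)"
  unfolding tensor_rel_def by (metis add_diff_add complex_vector.span_add)

lift_definition minus_tensor :: "('a, 'b) tensor \<Rightarrow> ('a, 'b) tensor \<Rightarrow> ('a, 'b) tensor" is "(-)"
proof -
  fix f g f' g' :: "('a \<times> 'b) \<Rightarrow>\<^sub>0 complex"
  assume "tensor_rel f g" "tensor_rel f' g'"
  then have "(f - g) - (f' - g') \<in> complex_vector.span tensor_relators"
    unfolding tensor_rel_def by (rule complex_vector.span_diff)
  then show "tensor_rel (f - f') (g - g')"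
    by (simp add: tensor_rel_def algebra_simps)
qed

lift_definition uminus_tensor :: "('a, 'b) tensor \<Rightarrow> ('a, 'b) tensor" is "uminus"
  unfolding tensor_rel_def by (metis complex_vector.span_neg minus_diff_minus)

lift_definition scaleC_tensor :: "complex \<Rightarrow> ('a, 'b) tensor \<Rightarrow> ('a, 'b) tensor" is "scaleC"
  unfolding tensor_rel_def by (metis complex_vector.span_scale complex_vector.scale_right_diff_distrib)

instance
  by standard (transfer; simp add: tensor_rel_def complex_vector.span_zero algebra_simps
      complex_vector.scale_right_distrib complex_vector.scale_left_distrib)+

end

lift_definition tensor :: "'a::complex_vector \<Rightarrow> 'b::complex_vector \<Rightarrow> ('a, 'b) tensor"
    (infixr "\<otimes>" 70)
  is "\<lambda>x y. Poly_Mapping.single (x, y) 1" .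

lemma tensor_relators_mem:
  "Poly_Mapping.single (x + x', y) 1 - Poly_Mapping.single (x, y) 1
    - Poly_Mapping.single (x', y) 1 \<in> tensor_relators"
  "Poly_Mapping.single (x, y + y') 1 - Poly_Mapping.single (x, y) 1
    - Poly_Mapping.single (x, y') 1 \<in> tensor_relators"
  "Poly_Mapping.single (c *\<^sub>C x, y) 1 - c *\<^sub>C Poly_Mapping.single (x, y) 1 \<in> tensor_relators"
  "Poly_Mapping.single (x, c *\<^sub>C y) 1 - c *\<^sub>C Poly_Mapping.single (x, y) 1 \<in> tensor_relators"
  unfolding tensor_relators_def
  subgoal by (rule UnI1, rule UnI1, rule UnI1, rule CollectI, rule exI[of _ x], rule exI[of _ x'],
        rule exI[of _ y], rule conjI[OF refl TrueI])
  subgoal by (rule UnI1, rule UnI1, rule UnI2, rule CollectI, rule exI[of _ x], rule exI[of _ y],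
        rule exI[of _ y'], rule conjI[OF refl TrueI])
  subgoal by (rule UnI1, rule UnI2, rule CollectI, rule exI[of _ c], rule exI[of _ x],
        rule exI[of _ y], rule conjI[OF refl TrueI])
  subgoal by (rule UnI2, rule CollectI, rule exI[of _ c], rule exI[of _ x],
        rule exI[of _ y], rule conjI[OF refl TrueI])
  done

lemma tensor_cbilinear: "cbilinear (\<otimes>)"
  unfolding cbilinear_def
proof (intro conjI allI clinearI)
  fix x x' :: 'a and y y' :: 'b and c
  note rel = tensor_relators_mem[THEN complex_vector.span_base]
  show "(x + x') \<otimes> y = x \<otimes> y + x' \<otimes> y"
    using rel(1)[of x x' y]
    by (simp add: tensor.abs_eq plus_tensor.abs_eq tensor.abs_eq_iff tensor_rel_def diff_diff_eq)
  show "x \<otimes> (y + y') = x \<otimes> y + x \<otimes> y'"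
    using rel(2)[of x y y']
    by (simp add: tensor.abs_eq plus_tensor.abs_eq tensor.abs_eq_iff tensor_rel_def diff_diff_eq)
  show "(c *\<^sub>C x) \<otimes> y = c *\<^sub>C (x \<otimes> y)"
    using rel(3)[of c x y]
    by (simp add: tensor.abs_eq scaleC_tensor.abs_eq tensor.abs_eq_iff tensor_rel_def)
  show "x \<otimes> (c *\<^sub>C y) = c *\<^sub>C (x \<otimes> y)"
    using rel(4)[of x c y]
    by (simp add: tensor.abs_eq scaleC_tensor.abs_eq tensor.abs_eq_iff tensor_rel_def)
qed

lemma poly_mapping_in_span_single:
  fixes f :: "'a \<Rightarrow>\<^sub>0 complex"
  shows "f \<in> complex_vector.span (range (\<lambda>k. Poly_Mapping.single k (1::complex)))"
proof -
  have "f = (\<Sum>k\<in>Poly_Mapping.keys f. Poly_Mapping.lookup f k *\<^sub>C Poly_Mapping.single k 1)"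
  proof (rule poly_mapping_eqI)
    fix i
    have "(\<Sum>k\<in>Poly_Mapping.keys f. Poly_Mapping.lookup f k *\<^sub>C Poly_Mapping.lookup (Poly_Mapping.single k 1) i)
       = (\<Sum>k\<in>Poly_Mapping.keys f. if k = i then Poly_Mapping.lookup f k else 0)"
      by (intro sum.cong) (auto simp: lookup_single when_def scaleC_complex_def)
    also have "\<dots> = Poly_Mapping.lookup f i"
      by (simp add: sum.delta in_keys_iff)
    finally show "Poly_Mapping.lookup f i = Poly_Mapping.lookup
        (\<Sum>k\<in>Poly_Mapping.keys f. Poly_Mapping.lookup f k *\<^sub>C Poly_Mapping.single k 1) i"
      by (simp add: lookup_sum lookup_scaleC)
  qed
  also have "\<dots> \<in> complex_vector.span (range (\<lambda>k. Poly_Mapping.single k (1::complex)))"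
    by (intro complex_vector.span_sum complex_vector.span_scale complex_vector.span_base) auto
  finally show ?thesis .
qed

lemma tensor_span_UNIV: "complex_vector.span {x \<otimes> y | x y. True} = UNIV"
proof -
  have "abs_tensor f \<in> complex_vector.span {x \<otimes> y | x y. True}" for f :: "('a \<times> 'b) \<Rightarrow>\<^sub>0 complex"
    using poly_mapping_in_span_single[of f]
  proof (induction rule: complex_vector.span_induct_alt)
    case base
    show ?case by (simp add: zero_tensor.abs_eq[symmetric] complex_vector.span_zero)
  next
    case (step c x g)
    from step(1) obtain a b where x: "x = Poly_Mapping.single (a, b) 1" by auto
    have "abs_tensor (c *\<^sub>C x + g) = c *\<^sub>C (a \<otimes> b) + abs_tensor g"
      by (simp add: x plus_tensor.abs_eq scaleC_tensor.abs_eq tensor.abs_eq)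
    moreover have "a \<otimes> b \<in> complex_vector.span {x \<otimes> y | x y. True}"
      by (rule complex_vector.span_base) auto
    ultimately show ?case
      using step(2) by (simp add: complex_vector.span_add complex_vector.span_scale)
  qed
  then have "t \<in> complex_vector.span {x \<otimes> y | x y. True}" for t :: "('a, 'b) tensor"
    by (rule tensor.abs_induct)
  then show ?thesis by blast
qed

text \<open>
  The linear map induced by a bilinear map; only meaningful when the argument is bilinear.
\<close>

definition tensor_lift ::
    "('a::complex_vector \<Rightarrow> 'b::complex_vector \<Rightarrow> 'c::complex_vector) \<Rightarrow> ('a, 'b) tensor \<Rightarrow> 'c" where
  "tensor_lift B = (THE f. clinear f \<and> (\<forall>x y. f (x \<otimes> y) = B x y))"

lemma clinear_tensor_eqI:
  fixes f g :: "('a::complex_vector, 'b::complex_vector) tensor \<Rightarrow> 'c::complex_vector"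
  assumes "clinear f" "clinear g" "\<And>x y. f (x \<otimes> y) = g (x \<otimes> y)"
  shows "f = g"
proof
  fix t :: "('a, 'b) tensor"
  interpret f: Vector_Spaces.linear scaleC scaleC f by fact
  interpret g: Vector_Spaces.linear scaleC scaleC g by fact
  have "t \<in> complex_vector.span {x \<otimes> y | x y. True}" unfolding tensor_span_UNIV by (rule UNIV_I)
  then show "f t = g t"
    by (induction rule: complex_vector.span_induct_alt)
      (auto simp: f.zero g.zero f.add g.add f.scale g.scale assms(3))
qed

lemma tensor_universal_property:
  fixes B :: "'a::complex_vector \<Rightarrow> 'b::complex_vector \<Rightarrow> 'c::complex_vector"
  assumes "cbilinear B"
  shows "\<exists>!f. clinear f \<and> (\<forall>x y. f (x \<otimes> y) = B x y)"
proof (rule ex_ex1I)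
  define F where "F f = (\<Sum>k\<in>Poly_Mapping.keys f. Poly_Mapping.lookup f k *\<^sub>C B (fst k) (snd k))"
    for f :: "('a \<times> 'b) \<Rightarrow>\<^sub>0 complex"
  have F_super: "F f = (\<Sum>k\<in>A. Poly_Mapping.lookup f k *\<^sub>C B (fst k) (snd k))"
    if "finite A" "Poly_Mapping.keys f \<subseteq> A" for f A
    unfolding F_def using that by (intro sum.mono_neutral_left) (auto simp: in_keys_iff)
  have F_lin: "clinear F"
  proof (rule clinearI)
    fix f g :: "('a \<times> 'b) \<Rightarrow>\<^sub>0 complex"
    let ?A = "Poly_Mapping.keys f \<union> Poly_Mapping.keys g"
    have "F (f + g) = (\<Sum>k\<in>?A. Poly_Mapping.lookup (f + g) k *\<^sub>C B (fst k) (snd k))"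
      by (rule F_super) (auto simp: in_keys_iff lookup_add)
    moreover have "F f = (\<Sum>k\<in>?A. Poly_Mapping.lookup f k *\<^sub>C B (fst k) (snd k))"
      by (rule F_super) auto
    moreover have "F g = (\<Sum>k\<in>?A. Poly_Mapping.lookup g k *\<^sub>C B (fst k) (snd k))"
      by (rule F_super) auto
    ultimately show "F (f + g) = F f + F g"
      by (simp add: lookup_add complex_vector.scale_left_distrib sum.distrib)
  next
    fix c and f :: "('a \<times> 'b) \<Rightarrow>\<^sub>0 complex"
    have "F (c *\<^sub>C f) = (\<Sum>k\<in>Poly_Mapping.keys f. Poly_Mapping.lookup (c *\<^sub>C f) k *\<^sub>C B (fst k) (snd k))"
      by (rule F_super) (auto simp: in_keys_iff lookup_scaleC)
    then show "F (c *\<^sub>C f) = c *\<^sub>C F f"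
      by (simp add: F_def lookup_scaleC complex_vector.scale_sum_right scaleC_complex_def)
  qed
  interpret F: Vector_Spaces.linear scaleC scaleC F by (rule F_lin)
  have F_single: "F (Poly_Mapping.single (x, y) 1) = B x y" for x y
    by (simp add: F_def)
  have B: "B (x + x') y = B x y + B x' y" "B x (y + y') = B x y + B x y'"
     "B (c *\<^sub>C x) y = c *\<^sub>C B x y" "B x (c *\<^sub>C y) = c *\<^sub>C B x y" for x x' y y' c
    using assms by (auto simp: cbilinear_def clinear_iff)
  have F_zero: "F f = 0" if "f \<in> complex_vector.span tensor_relators" for f
    using that
  proof (induction rule: complex_vector.span_induct_alt)
    case base
    show ?case by (rule F.zero)
  next
    case (step c x y)
    have "F x = 0"
      using step(1) unfolding tensor_relators_def
      by (auto simp: F.diff F.scale F_single B)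
    then show ?case using step(2) by (simp add: F.add F.scale)
  qed
  have F_resp: "F f = F g" if "tensor_rel f g" for f g
    using F_zero[of "f - g"] that by (simp add: tensor_rel_def F.diff)
  define G where "G t = F (rep_tensor t)" for t
  have G_abs: "G (abs_tensor f) = F f" for f
    unfolding G_def
    by (rule F_resp) (metis Quotient3_tensor Quotient3_rep_abs tensor_rel_equivp equivp_reflp)
  have "clinear G"
  proof (rule clinearI)
    fix s t :: "('a, 'b) tensor" and c
    obtain f g where [simp]: "s = abs_tensor f" "t = abs_tensor g"
      by (metis Quotient3_tensor Quotient3_abs_rep)
    show "G (s + t) = G s + G t" by (simp add: plus_tensor.abs_eq G_abs F.add)
    show "G (c *\<^sub>C s) = c *\<^sub>C G s" by (simp add: scaleC_tensor.abs_eq G_abs F.scale)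
  qed
  moreover have "G (x \<otimes> y) = B x y" for x y
    by (simp add: tensor.abs_eq G_abs F_single)
  ultimately show "\<exists>f. clinear f \<and> (\<forall>x y. f (x \<otimes> y) = B x y)" by blast
next
  fix f g :: "('a, 'b) tensor \<Rightarrow> 'c"
  assume "clinear f \<and> (\<forall>x y. f (x \<otimes> y) = B x y)" "clinear g \<and> (\<forall>x y. g (x \<otimes> y) = B x y)"
  then show "f = g" by (intro clinear_tensor_eqI) auto
qed

lemma tensor_lift_clinear: "cbilinear B \<Longrightarrow> clinear (tensor_lift B)"
  and tensor_lift_tensor: "cbilinear B \<Longrightarrow> tensor_lift B (x \<otimes> y) = B x y"
  using theI'[OF tensor_universal_property, of B] unfolding tensor_lift_def by auto

definition tensor_map ::
    "('a::complex_vector \<Rightarrow> 'c::complex_vector) \<Rightarrow> ('b::complex_vector \<Rightarrow> 'd::complex_vector)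
      \<Rightarrow> ('a, 'b) tensor \<Rightarrow> ('c, 'd) tensor" where
  "tensor_map f g = tensor_lift (\<lambda>x y. f x \<otimes> g y)"

definition tensor_assoc ::
    "(('a::complex_vector, 'b::complex_vector) tensor, 'c::complex_vector) tensor
      \<Rightarrow> ('a, ('b, 'c) tensor) tensor" where
  "tensor_assoc = tensor_lift (\<lambda>t z. tensor_lift (\<lambda>x y. x \<otimes> (y \<otimes> z)) t)"

definition tensor_lunit :: "(complex, 'a::complex_vector) tensor \<Rightarrow> 'a" where
  "tensor_lunit = tensor_lift (\<lambda>c x. c *\<^sub>C x)"

definition tensor_runit :: "('a::complex_vector, complex) tensor \<Rightarrow> 'a" where
  "tensor_runit = tensor_lift (\<lambda>x c. c *\<^sub>C x)"

text \<open>
  The componentwise product on a tensor product of two spaces with bilinear products \<open>p\<close>, \<open>q\<close>,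
  determined by \<open>(a \<otimes> b) \<bullet> (a' \<otimes> b') = p a a' \<otimes> q b b'\<close>.
\<close>

definition tensor_mult ::
    "('a::complex_vector \<Rightarrow> 'a \<Rightarrow> 'a) \<Rightarrow> ('b::complex_vector \<Rightarrow> 'b \<Rightarrow> 'b)
      \<Rightarrow> ('a, 'b) tensor \<Rightarrow> ('a, 'b) tensor \<Rightarrow> ('a, 'b) tensor" where
  "tensor_mult p q s t =
     tensor_lift (\<lambda>a b. tensor_lift (\<lambda>a' b'. p a a' \<otimes> q b b') t) s"

lemma cbilinear_iff:
  "cbilinear B \<longleftrightarrow>
    (\<forall>x x' y. B (x + x') y = B x y + B x' y) \<and> (\<forall>c x y. B (c *\<^sub>C x) y = c *\<^sub>C B x y) \<and>
    (\<forall>x y y'. B x (y + y') = B x y + B x y') \<and> (\<forall>c x y. B x (c *\<^sub>C y) = c *\<^sub>C B x y)"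
  by (auto simp: cbilinear_def clinear_iff)

lemmas tensor_bilinear_simps = tensor_cbilinear[unfolded cbilinear_iff, rule_format]

lemma tensor_map_tensor:
  assumes "clinear f" "clinear g"
  shows "tensor_map f g (x \<otimes> y) = f x \<otimes> g y"
  using assms unfolding tensor_map_def
  by (subst tensor_lift_tensor) (auto simp: cbilinear_iff clinear_iff tensor_bilinear_simps)

lemma tensor_lunit_tensor: "tensor_lunit (c \<otimes> x) = c *\<^sub>C x"
  unfolding tensor_lunit_def
  by (rule tensor_lift_tensor)
    (auto simp: cbilinear_iff scaleC_complex_def complex_vector.scale_right_distrib
      complex_vector.scale_left_distrib mult_ac)

lemma tensor_runit_tensor: "tensor_runit (x \<otimes> c) = c *\<^sub>C x"
  unfolding tensor_runit_def
  by (rule tensor_lift_tensor)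
    (auto simp: cbilinear_iff scaleC_complex_def complex_vector.scale_right_distrib
      complex_vector.scale_left_distrib mult_ac)

lemma tensor_lift_add:
  assumes "cbilinear B" "cbilinear C"
  shows "tensor_lift (\<lambda>x y. B x y + C x y) t = tensor_lift B t + tensor_lift C t"
proof -
  have bl: "cbilinear (\<lambda>x y. B x y + C x y)"
    using assms by (auto simp: cbilinear_iff complex_vector.scale_right_distrib)
  have "tensor_lift (\<lambda>x y. B x y + C x y) = (\<lambda>t. tensor_lift B t + tensor_lift C t)"
    using tensor_lift_clinear[OF assms(1)] tensor_lift_clinear[OF assms(2)]
    by (intro clinear_tensor_eqI tensor_lift_clinear bl)
      (auto simp: clinear_iff complex_vector.scale_right_distrib tensor_lift_tensor bl assms)
  then show ?thesis by simp
qed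

lemma tensor_lift_scaleC:
  assumes "cbilinear B"
  shows "tensor_lift (\<lambda>x y. c *\<^sub>C B x y) t = c *\<^sub>C tensor_lift B t"
proof -
  have bl: "cbilinear (\<lambda>x y. c *\<^sub>C B x y)"
    using assms by (auto simp: cbilinear_iff complex_vector.scale_right_distrib mult_ac)
  have "tensor_lift (\<lambda>x y. c *\<^sub>C B x y) = (\<lambda>t. c *\<^sub>C tensor_lift B t)"
    using tensor_lift_clinear[OF assms]
    by (intro clinear_tensor_eqI tensor_lift_clinear bl)
      (auto simp: clinear_iff complex_vector.scale_right_distrib tensor_lift_tensor bl assms mult_ac)
  then show ?thesis by simp
qed

lemma tensor_assoc_tensor:
  fixes x :: "'a::complex_vector" and y :: "'b::complex_vector" and z :: "'c::complex_vector"
  shows "tensor_assoc ((x \<otimes> y) \<otimes> z) = x \<otimes> (y \<otimes> z)"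
proof -
  have bl: "cbilinear (\<lambda>(x::'a) (y::'b). x \<otimes> (y \<otimes> z))" for z :: 'c
    by (auto simp: cbilinear_iff tensor_bilinear_simps)
  have "cbilinear (\<lambda>t (z::'c). tensor_lift (\<lambda>(x::'a) (y::'b). x \<otimes> (y \<otimes> z)) t)"
    using tensor_lift_clinear[OF bl, unfolded clinear_iff]
    by (simp add: cbilinear_iff tensor_bilinear_simps tensor_lift_add[OF bl bl]
        tensor_lift_scaleC[OF bl])
  then show ?thesis by (simp add: tensor_assoc_def tensor_lift_tensor bl)
qed

lemma tensor_mult_tensor:
  assumes "cbilinear p" "cbilinear q"
  shows "tensor_mult p q (a \<otimes> b) (a' \<otimes> b') = p a a' \<otimes> q b b'"
proof -
  have bl: "cbilinear (\<lambda>a' b'. p a a' \<otimes> q b b')" for a b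
    using assms by (auto simp: cbilinear_iff tensor_bilinear_simps)
  have "cbilinear (\<lambda>a b. tensor_lift (\<lambda>a' b'. p a a' \<otimes> q b b') t)" for t
    using assms tensor_lift_add[OF bl bl] tensor_lift_scaleC[OF bl]
    by (simp add: cbilinear_iff tensor_bilinear_simps)
  then have "tensor_mult p q (a \<otimes> b) (a' \<otimes> b')
      = tensor_lift (\<lambda>a' b'. p a a' \<otimes> q b b') (a' \<otimes> b')"
    unfolding tensor_mult_def by (subst tensor_lift_tensor) auto
  also have "\<dots> = p a a' \<otimes> q b b'"
    by (subst tensor_lift_tensor) (auto intro: bl)
  finally show ?thesis .
qed


section \<open>Weak Hopf algebras\<close>

record (overloaded) 'v weak_hopf_data =
  mult :: "('v::complex_vector, 'v) tensor \<Rightarrow> 'v"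
  unit :: "complex \<Rightarrow> 'v"
  comult :: "'v \<Rightarrow> ('v, 'v) tensor"
  counit :: "'v \<Rightarrow> complex"
  antipode :: "'v \<Rightarrow> 'v"

definition prod1 :: "'v::complex_vector weak_hopf_data \<Rightarrow> 'v \<Rightarrow> 'v \<Rightarrow> 'v" where
  "prod1 H x y = mult H (x \<otimes> y)"

definition prod2 :: "'v::complex_vector weak_hopf_data
    \<Rightarrow> ('v, 'v) tensor \<Rightarrow> ('v, 'v) tensor \<Rightarrow> ('v, 'v) tensor" where
  "prod2 H = tensor_mult (prod1 H) (prod1 H)"

definition prod3 :: "'v::complex_vector weak_hopf_data
    \<Rightarrow> ('v, ('v, 'v) tensor) tensor \<Rightarrow> ('v, ('v, 'v) tensor) tensor
    \<Rightarrow> ('v, ('v, 'v) tensor) tensor" where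
  "prod3 H = tensor_mult (prod1 H) (prod2 H)"

definition one :: "'v::complex_vector weak_hopf_data \<Rightarrow> 'v" where
  "one H = unit H 1"

definition unital_assoc_algebra :: "'v::complex_vector weak_hopf_data \<Rightarrow> bool" where
  "unital_assoc_algebra H \<longleftrightarrow>
     clinear (mult H) \<and> clinear (unit H) \<and>
     (\<forall>x y z. prod1 H (prod1 H x y) z = prod1 H x (prod1 H y z)) \<and>
     (\<forall>x. prod1 H (one H) x = x \<and> prod1 H x (one H) = x)"

definition counital_coassoc_coalgebra :: "'v::complex_vector weak_hopf_data \<Rightarrow> bool" where
  "counital_coassoc_coalgebra H \<longleftrightarrow>
     clinear (comult H) \<and> clinear (counit H) \<and>
     (\<forall>x. tensor_assoc (tensor_map (comult H) id (comult H x))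
            = tensor_map id (comult H) (comult H x)) \<and>
     (\<forall>x. tensor_lunit (tensor_map (counit H) id (comult H x)) = x) \<and>
     (\<forall>x. tensor_runit (tensor_map id (counit H) (comult H x)) = x)"

text \<open>
  Triple tensors are compared in the right-nested form, via the associator. In the last axiom,
  \<open>tensor_lift\<close> evaluates the Sweedler expression \<open>\<epsilon>(x y\<^sub>1) \<epsilon>(y\<^sub>2 z)\<close>.
\<close>

definition weak_bialgebra :: "'v::complex_vector weak_hopf_data \<Rightarrow> bool" where
  "weak_bialgebra H \<longleftrightarrow>
     unital_assoc_algebra H \<and> counital_coassoc_coalgebra H \<and>
     (\<forall>x y. comult H (prod1 H x y) = prod2 H (comult H x) (comult H y)) \<and>
     tensor_assoc (tensor_map (comult H) id (comult H (one H)))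
       = prod3 H (tensor_assoc (comult H (one H) \<otimes> one H)) (one H \<otimes> comult H (one H)) \<and>
     tensor_assoc (tensor_map (comult H) id (comult H (one H)))
       = prod3 H (one H \<otimes> comult H (one H)) (tensor_assoc (comult H (one H) \<otimes> one H)) \<and>
     (\<forall>x y z. counit H (prod1 H (prod1 H x y) z)
        = tensor_lift (\<lambda>y1 y2. counit H (prod1 H x y1) * counit H (prod1 H y2 z)) (comult H y))"

definition weak_hopf_algebra :: "'v::complex_vector weak_hopf_data \<Rightarrow> bool" where
  "weak_hopf_algebra H \<longleftrightarrow>
     weak_bialgebra H \<and> clinear (antipode H) \<and>
     (\<forall>x. mult H (tensor_map id (antipode H) (comult H x))
        = tensor_lunit (tensor_map (counit H) id (prod2 H (comult H (one H)) (x \<otimes> one H)))) \<and>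
     (\<forall>x. mult H (tensor_map (antipode H) id (comult H x))
        = tensor_runit (tensor_map id (counit H) (prod2 H (one H \<otimes> x) (comult H (one H))))) \<and>
     (\<forall>x. mult H (tensor_map (mult H) id
            (tensor_map (tensor_map (antipode H) id) (antipode H)
              (tensor_map (comult H) id (comult H x)))) = antipode H x)"

definition weak_hopf_iso ::
    "'v::complex_vector weak_hopf_data \<Rightarrow> 'w::complex_vector weak_hopf_data \<Rightarrow> bool" where
  "weak_hopf_iso H K \<longleftrightarrow>
     (\<exists>f. clinear f \<and> bij f \<and>
        (\<forall>t. f (mult H t) = mult K (tensor_map f f t)) \<and>
        (\<forall>x. tensor_map f f (comult H x) = comult K (f x)) \<and>
        (\<forall>x. counit K (f x) = counit H x) \<and>
        (\<forall>x. f (antipode H x) = antipode K (f x)))"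


section \<open>The algebra \<open>\<A>\<close> and the two weak Hopf algebras\<close>

abbreviation e1 :: "complex^2" where "e1 \<equiv> axis 1 1"
abbreviation e2 :: "complex^2" where "e2 \<equiv> axis 2 1"

text \<open>The linear map sending \<open>e1\<close> to \<open>a\<close> and \<open>e2\<close> to \<open>b\<close>.\<close>

definition lin_ext :: "'b::complex_vector \<Rightarrow> 'b \<Rightarrow> complex^2 \<Rightarrow> 'b" where
  "lin_ext a b x = (x $ 1) *\<^sub>C a + (x $ 2) *\<^sub>C b"

definition A_mult :: "(complex^2, complex^2) tensor \<Rightarrow> complex^2" where
  "A_mult = tensor_lift (\<lambda>x y. lin_ext (lin_ext e1 e2 y) (lin_ext e2 e2 y) x)"

definition A_unit :: "complex \<Rightarrow> complex^2" where
  "A_unit c = c *\<^sub>C e1"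

definition weak_hopf_1 :: "(complex^2) weak_hopf_data" where
  "weak_hopf_1 =
     \<lparr> mult = A_mult, unit = A_unit,
       comult = lin_ext (e1 \<otimes> e1) ((e1 - e2) \<otimes> (e1 - e2) + e2 \<otimes> e2),
       counit = lin_ext 1 1,
       antipode = lin_ext e1 e2 \<rparr>"

definition weak_hopf_2 :: "(complex^2) weak_hopf_data" where
  "weak_hopf_2 =
     \<lparr> mult = A_mult, unit = A_unit,
       comult = lin_ext ((e1 - e2) \<otimes> (e1 - e2) + e2 \<otimes> e2) (e2 \<otimes> e2),
       counit = lin_ext 2 1,
       antipode = lin_ext e1 e2 \<rparr>"

lemma lin_ext_clinear: "clinear (lin_ext a b)"
  by (rule clinearI) (simp_all add: lin_ext_def scaleC_vec_def scaleC_complex_def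
      complex_vector.scale_left_distrib complex_vector.scale_right_distrib)

lemma lin_ext_e: "lin_ext a b e1 = a" "lin_ext a b e2 = b"
  by (simp_all add: lin_ext_def axis_def)

lemma A_mult_cbilinear: "cbilinear (\<lambda>x y. lin_ext (lin_ext e1 e2 y) (lin_ext e2 e2 y) x)"
  by (simp add: cbilinear_iff lin_ext_def scaleC_vec_def scaleC_complex_def vec_eq_iff algebra_simps)

lemma A_mult_table:
  "A_mult (e1 \<otimes> e1) = e1" "A_mult (e1 \<otimes> e2) = e2"
  "A_mult (e2 \<otimes> e1) = e2" "A_mult (e2 \<otimes> e2) = e2"
  by (simp_all add: A_mult_def tensor_lift_tensor[OF A_mult_cbilinear] lin_ext_e)

end

theory Submission
  imports Defs
begin

text \<open>
  A two-dimensional unital algebra is generated by \<open>1\<close> and one further element, and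
  completing the square in the quadratic equation of that element gives a generator \<open>y\<close> with
  \<open>y\<^sup>2 = d \<cdot> 1\<close>. So the algebra is either the dual numbers (\<open>d = 0\<close>) or the algebra
  of functions on two points (\<open>d \<noteq> 0\<close>), which is \<open>\<A>\<close> with its idempotents \<open>e\<^sub>2\<close> and
  \<open>e\<^sub>1 - e\<^sub>2\<close>; this is \<open>exists_idempotent_basis\<close>.

  The dual numbers carry no weak Hopf structure (\<open>not_dual_numbers\<close>). Their tensor square is local,
  so the idempotent \<open>\<Delta>(1)\<close> is \<open>1 \<otimes> 1\<close>. For the nilpotent generator \<open>v\<close>, the
  conditions \<open>\<Delta>(v)\<^sup>2 = 0\<close> and the counit laws force \<open>\<Delta>(v) = c \<cdot> v \<otimes> v\<close> with
  \<open>c \<epsilon>(v) = 1\<close>. But then the antipode axiom reads \<open>c \<cdot> v S(v) = \<epsilon>(v) \<cdot> 1\<close>, whose left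
  side is a multiple of \<open>v\<close>; hence \<open>\<epsilon>(v) = 0\<close>, a contradiction.

  On the functions on two points with delta functions \<open>u\<close>, \<open>v\<close>, the elements \<open>\<Delta>(u)\<close> and
  \<open>\<Delta>(v)\<close> are orthogonal idempotents in the functions on pairs of points. Their coefficients
  are therefore 0 or 1, and \<open>\<Delta>\<close> amounts to a partial multiplication on the two points. The counit
  laws make it commutative, and together with the antipode axioms they leave only the two groupoids
  with two arrows: two objects with their identities, and the group of order two, in which either
  point may be the identity (\<open>two_point_structure_constants\<close>, \<open>tables_if_weak_hopf_algebra\<close>). The
  antipode comes out as the identity map in both cases. In the basis \<open>e\<^sub>2\<close>, \<open>e\<^sub>1 - e\<^sub>2\<close> the
  first structure of the theorem is that of the group and the second that of the discrete groupoid.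
  They are not isomorphic because \<open>\<epsilon>(1)\<close>, the number of objects, is an invariant.
\<close>

section \<open>Linear maps out of tensor products\<close>

text \<open>
  These rules have a function variable at their head, so they rewrite safely only after
  instantiation with a particular linear map.
\<close>

lemma clinear_simps:
  assumes "clinear f"
  shows "f (x + y) = f x + f y" "f (c *\<^sub>C x) = c *\<^sub>C f x" "f 0 = 0"
proof -
  interpret Vector_Spaces.linear scaleC scaleC f by fact
  show "f (x + y) = f x + f y" "f (c *\<^sub>C x) = c *\<^sub>C f x" "f 0 = 0"
    by (rule add scale zero)+
qed

lemma cbilinear_simps:
  assumes "cbilinear B"
  shows "B (x + x') y = B x y + B x' y" "B x (y + y') = B x y + B x y'"
    "B (c *\<^sub>C x) y = c *\<^sub>C B x y" "B x (c *\<^sub>C y) = c *\<^sub>C B x y"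
    "B 0 y = 0" "B x 0 = 0"
  using assms clinear_simps[of "\<lambda>x. B x y"] clinear_simps[of "\<lambda>y. B x y"]
  by (auto simp: cbilinear_def)

lemma scaleC_complex: "c *\<^sub>C (z::complex) = c * z"
  by (simp add: scaleC_complex_def)

lemma clinear_id [simp]: "clinear id"
  by (simp add: clinear_iff)

lemma clinear_tensor_map [simp]:
  "clinear f \<Longrightarrow> clinear g \<Longrightarrow> clinear (tensor_map f g)"
  unfolding tensor_map_def
  by (rule tensor_lift_clinear) (auto simp: cbilinear_iff clinear_iff tensor_bilinear_simps)

lemma clinear_tensor_lunit: "clinear (tensor_lunit :: _ \<Rightarrow> 'a::complex_vector)"
  unfolding tensor_lunit_def
  by (rule tensor_lift_clinear)
    (auto simp: cbilinear_iff scaleC_complex complex_vector.scale_right_distrib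
      complex_vector.scale_left_distrib mult_ac)

lemma clinear_tensor_runit: "clinear (tensor_runit :: _ \<Rightarrow> 'a::complex_vector)"
  unfolding tensor_runit_def
  by (rule tensor_lift_clinear)
    (auto simp: cbilinear_iff scaleC_complex complex_vector.scale_right_distrib
      complex_vector.scale_left_distrib mult_ac)

lemma clinear_tensor_assoc: "clinear tensor_assoc"
proof -
  have bl: "cbilinear (\<lambda>x y. x \<otimes> (y \<otimes> z))" for z :: 'c
    by (auto simp: cbilinear_iff tensor_bilinear_simps)
  show ?thesis
    unfolding tensor_assoc_def
    by (rule tensor_lift_clinear)
      (simp add: cbilinear_iff tensor_bilinear_simps tensor_lift_add[OF bl bl]
        tensor_lift_scaleC[OF bl] clinear_simps[OF tensor_lift_clinear[OF bl]])
qed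

lemma cbilinear_tensor_mult:
  assumes "cbilinear p" "cbilinear q"
  shows "cbilinear (tensor_mult p q)"
proof -
  have inner: "cbilinear (\<lambda>a' b'. p a a' \<otimes> q b b')" for a b
    by (simp add: cbilinear_iff cbilinear_simps[OF assms(1)] cbilinear_simps[OF assms(2)]
        tensor_bilinear_simps)
  have outer: "cbilinear (\<lambda>a b. tensor_lift (\<lambda>a' b'. p a a' \<otimes> q b b') t)" for t
    using tensor_lift_add[OF inner inner] tensor_lift_scaleC[OF inner]
    by (simp add: cbilinear_iff cbilinear_simps[OF assms(1)] cbilinear_simps[OF assms(2)]
        tensor_bilinear_simps)
  show ?thesis
    unfolding tensor_mult_def
    by (simp add: cbilinear_def tensor_lift_clinear[OF outer] clinear_iff
        clinear_simps[OF tensor_lift_clinear[OF inner]] clinear_simps[OF tensor_lift_clinear[OF outer]]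
        tensor_lift_add[OF outer outer] tensor_lift_scaleC[OF outer])
qed

section \<open>Two-dimensional spaces in coordinates\<close>

text \<open>
  The coordinate functionals are parameters, so that concrete bases come with explicit formulas
  for them.
\<close>

locale basis_pair =
  fixes u v :: "'v::complex_vector" and X Y :: "'v \<Rightarrow> complex"
  assumes X_lin: "clinear X" and Y_lin: "clinear Y"
    and coord_basis [simp]: "X u = 1" "X v = 0" "Y u = 0" "Y v = 1"
    and expand: "x = X x *\<^sub>C u + Y x *\<^sub>C v"
begin

lemma coord_simps [simp]:
  "X (x + y) = X x + X y" "X (c *\<^sub>C x) = c * X x" "X 0 = 0"
  "Y (x + y) = Y x + Y y" "Y (c *\<^sub>C x) = c * Y x" "Y 0 = 0"
  by (simp_all add: clinear_simps[OF X_lin] clinear_simps[OF Y_lin] scaleC_complex)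

lemma coord_eqI: "X x = X y \<Longrightarrow> Y x = Y y \<Longrightarrow> x = y"
  by (subst expand[of x], subst expand[of y]) simp

lemma eq_on_basis:
  assumes "clinear f" "clinear g" "\<And>w. w \<in> {u, v} \<Longrightarrow> f w = g w"
  shows "f x = g x"
  by (subst (1 2) expand[of x])
    (simp add: clinear_simps[OF assms(1)] clinear_simps[OF assms(2)] assms(3))

definition vec2 :: "complex \<Rightarrow> complex \<Rightarrow> 'v" where
  "vec2 a b = a *\<^sub>C u + b *\<^sub>C v"

lemma vec2_eq_iff: "vec2 a b = vec2 a' b' \<longleftrightarrow> a = a' \<and> b = b'"
proof
  assume "vec2 a b = vec2 a' b'"
  then have "X (vec2 a b) = X (vec2 a' b')" "Y (vec2 a b) = Y (vec2 a' b')" by simp_all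
  then show "a = a' \<and> b = b'" by (simp add: vec2_def)
qed simp

lemma vec2_basis: "u = vec2 1 0" "v = vec2 0 1"
  by (simp_all add: vec2_def complex_vector.scale_one)

lemma vec2_cases: obtains a b where "x = vec2 a b"
  by (rule that[of "X x" "Y x"]) (simp add: vec2_def expand[symmetric])

definition ten2 :: "complex \<Rightarrow> complex \<Rightarrow> complex \<Rightarrow> complex \<Rightarrow> ('v, 'v) tensor" where
  "ten2 a b c d = a *\<^sub>C (u \<otimes> u) + b *\<^sub>C (u \<otimes> v) + c *\<^sub>C (v \<otimes> u) + d *\<^sub>C (v \<otimes> v)"

lemma clinear_ten2:
  assumes "clinear F"
  shows "F (ten2 a b c d)
     = a *\<^sub>C F (u \<otimes> u) + b *\<^sub>C F (u \<otimes> v) + c *\<^sub>C F (v \<otimes> u) + d *\<^sub>C F (v \<otimes> v)"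
  by (simp add: ten2_def clinear_simps[OF assms])

lemma coord_tensor:
  assumes "f \<in> {X, Y}" "g \<in> {X, Y}"
  shows "clinear (tensor_lift (\<lambda>x y. f x * g y))"
    "tensor_lift (\<lambda>x y. f x * g y) (x \<otimes> y) = f x * g y"
proof -
  have "cbilinear (\<lambda>x y. f x * g y)"
    using assms by (auto simp: cbilinear_iff scaleC_complex algebra_simps)
  then show "clinear (tensor_lift (\<lambda>x y. f x * g y))"
    "tensor_lift (\<lambda>x y. f x * g y) (x \<otimes> y) = f x * g y"
    by (rule tensor_lift_clinear, rule tensor_lift_tensor)
qed

text \<open>
  Products of coordinate functionals separate the four elementary tensors. This is the linear
  independence that turns identities in the tensor square into equations between coefficients.
\<close>

lemma coord_ten2:
  "tensor_lift (\<lambda>x y. X x * X y) (ten2 a b c d) = a"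
  "tensor_lift (\<lambda>x y. X x * Y y) (ten2 a b c d) = b"
  "tensor_lift (\<lambda>x y. Y x * X y) (ten2 a b c d) = c"
  "tensor_lift (\<lambda>x y. Y x * Y y) (ten2 a b c d) = d"
  by (simp_all add: clinear_ten2[OF coord_tensor(1)] coord_tensor(2) scaleC_complex)

lemma ten2_eq_iff:
  "ten2 a b c d = ten2 a' b' c' d' \<longleftrightarrow> a = a' \<and> b = b' \<and> c = c' \<and> d = d'"
  using coord_ten2[of a b c d] coord_ten2[of a' b' c' d'] by auto

lemma tensor_vec2: "vec2 a b \<otimes> vec2 c d = ten2 (a * c) (a * d) (b * c) (b * d)"
  by (simp add: vec2_def ten2_def tensor_bilinear_simps complex_vector.scale_right_distrib
      mult_ac add_ac)

lemma ten2_add: "ten2 a b c d + ten2 a' b' c' d' = ten2 (a + a') (b + b') (c + c') (d + d')"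
  by (simp add: ten2_def complex_vector.scale_left_distrib add_ac)

lemma ten2_scale: "k *\<^sub>C ten2 a b c d = ten2 (k * a) (k * b) (k * c) (k * d)"
  by (simp add: ten2_def complex_vector.scale_right_distrib)

lemma ten2_cases: obtains a b c d where "t = ten2 a b c d"
proof -
  have "t \<in> complex_vector.span {x \<otimes> y | x y. True}"
    unfolding tensor_span_UNIV by (rule UNIV_I)
  then have "\<exists>a b c d. t = ten2 a b c d"
  proof (induction rule: complex_vector.span_induct_alt)
    case base
    have "0 = ten2 0 0 0 0" by (simp add: ten2_def)
    then show ?case by blast
  next
    case (step k x y)
    then obtain x1 x2 where "x = x1 \<otimes> x2" by auto
    then obtain a b c d where "x = vec2 a b \<otimes> vec2 c d" by (metis vec2_cases)
    then have "x = ten2 (a * c) (a * d) (b * c) (b * d)" by (simp add: tensor_vec2)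
    with step(2) show ?case by (metis ten2_scale ten2_add)
  qed
  then show thesis using that by blast
qed

text \<open>The new coordinates are given by Cramer's rule.\<close>

lemma change_basis:
  assumes D: "a * d - b * c \<noteq> 0"
  shows "basis_pair (vec2 a b) (vec2 c d)
    (\<lambda>z. (d * X z - c * Y z) / (a * d - b * c)) (\<lambda>z. (a * Y z - b * X z) / (a * d - b * c))"
proof (rule basis_pair.intro)
  let ?D = "a * d - b * c"
  show "clinear (\<lambda>z. (d * X z - c * Y z) / ?D)" "clinear (\<lambda>z. (a * Y z - b * X z) / ?D)"
    by (rule clinearI; simp add: scaleC_complex diff_divide_distrib add_divide_distrib algebra_simps)+
  fix z
  have "(d * X z - c * Y z) * a + (a * Y z - b * X z) * c = X z * ?D"
       "(d * X z - c * Y z) * b + (a * Y z - b * X z) * d = Y z * ?D"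
    by (simp_all add: algebra_simps)
  then have "(d * X z - c * Y z) / ?D * a + (a * Y z - b * X z) / ?D * c = X z"
       "(d * X z - c * Y z) / ?D * b + (a * Y z - b * X z) / ?D * d = Y z"
    using D by (simp_all flip: add_divide_distrib)
  then show "z = ((d * X z - c * Y z) / ?D) *\<^sub>C vec2 a b + ((a * Y z - b * X z) / ?D) *\<^sub>C vec2 c d"
    by (intro coord_eqI) (simp_all add: vec2_def)
qed (use D in \<open>simp_all add: vec2_def mult.commute\<close>)

lemma independent_basis: "complex_vector.independent {u, v}" and basis_distinct: "u \<noteq> v"
proof -
  show ne: "u \<noteq> v" using coord_basis by (metis zero_neq_one)
  have "u \<notin> complex_vector.span {v}"
  proof
    assume "u \<in> complex_vector.span {v}"
    then obtain k where "u = k *\<^sub>C v" by (auto simp: complex_vector.span_singleton)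
    then have "X u = k * X v" by (metis coord_simps(2))
    then show False by simp
  qed
  moreover have "v \<noteq> 0" using coord_basis(4) coord_simps(6) by (metis zero_neq_one)
  ultimately show "complex_vector.independent {u, v}"
    using ne by (simp add: complex_vector.independent_insert)
qed

lemma dim_UNIV_eq_2: "complex_vector.dim (UNIV :: 'v set) = 2"
proof -
  have "x \<in> complex_vector.span {u, v}" for x
    by (subst expand[of x])
      (intro complex_vector.span_add complex_vector.span_scale complex_vector.span_base; simp)
  then have "complex_vector.span {u, v} = complex_vector.span UNIV" by auto
  then have "complex_vector.dim (UNIV :: 'v set) = card {u, v}"
    by (rule complex_vector.dim_eq_card) (rule independent_basis)
  then show ?thesis using basis_distinct by simp
qed

end


text \<open>
  The basis has to extend a given vector because it is applied with the unit of an algebra, which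
  fixes half of the multiplication table.
\<close>

lemma exists_basis_pair:
  assumes "complex_vector.dim (UNIV :: 'v::complex_vector set) = 2" "(w::'v) \<noteq> 0"
  shows "\<exists>x X Y. basis_pair w x X Y"
proof -
  have "complex_vector.independent {w}" using assms(2) by simp
  then obtain B where B: "{w} \<subseteq> B" "complex_vector.independent B" "UNIV \<subseteq> complex_vector.span B"
    by (rule complex_vector.maximal_independent_subset_extend[OF subset_UNIV]) blast
  have "card B = complex_vector.dim (UNIV :: 'v set)"
    using B by (intro complex_vector.basis_card_eq_dim) auto
  then have card: "card B = 2" using assms(1) by simp
  then obtain x where Bx: "B = {w, x}" "w \<noteq> x"
    using B(1) by (auto simp: card_2_iff)
  then have mem: "w \<in> B" "x \<in> B" by auto
  define R where "R = complex_vector.representation B"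
  have span: "z \<in> complex_vector.span B" for z using B(3) by blast
  have "basis_pair w x (\<lambda>z. R z w) (\<lambda>z. R z x)"
  proof (rule basis_pair.intro)
    show "clinear (\<lambda>z. R z w)" "clinear (\<lambda>z. R z x)"
      unfolding R_def
      by (rule clinearI; simp add: complex_vector.representation_add complex_vector.representation_scale
          B(2) span scaleC_complex)+
    show "R w w = 1" "R x w = 0" "R w x = 0" "R x x = 1"
      using mem Bx(2) by (simp_all add: R_def complex_vector.representation_basis[OF B(2)])
    show "z = R z w *\<^sub>C w + R z x *\<^sub>C x" for z
      using complex_vector.sum_representation_eq[OF B(2) span[of z] _ subset_refl] Bx
      by (simp add: R_def)
  qed
  then show ?thesis by blast
qed

section \<open>Structures with bilinear operations\<close>

lemma cbilinear_prod1:
  assumes "clinear (mult H)"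
  shows "cbilinear (prod1 H)"
  by (simp add: cbilinear_iff prod1_def tensor_bilinear_simps clinear_simps[OF assms])

text \<open>
  Linearity of the operations suffices for evaluating every tensor expression that occurs in the
  axioms. It is kept apart from the axioms themselves because they are sometimes hypotheses and
  sometimes goals.
\<close>

locale linear_structure =
  fixes H :: "'v::complex_vector weak_hopf_data"
  assumes mult_lin [simp]: "clinear (mult H)"
    and unit_lin: "clinear (unit H)"
    and comult_lin [simp]: "clinear (comult H)"
    and counit_lin [simp]: "clinear (counit H)"
    and antipode_lin [simp]: "clinear (antipode H)"
begin

lemmas prod1_bil = cbilinear_prod1[OF mult_lin]
lemma prod2_bil: "cbilinear (prod2 H)"
  unfolding prod2_def by (rule cbilinear_tensor_mult[OF prod1_bil prod1_bil])
lemma prod3_bil: "cbilinear (prod3 H)"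
  unfolding prod3_def by (rule cbilinear_tensor_mult[OF prod1_bil prod2_bil])

lemma prod2_tensor: "prod2 H (a \<otimes> b) (a' \<otimes> b') = prod1 H a a' \<otimes> prod1 H b b'"
  unfolding prod2_def by (rule tensor_mult_tensor[OF prod1_bil prod1_bil])
lemma prod3_tensor: "prod3 H (a \<otimes> b) (a' \<otimes> b') = prod1 H a a' \<otimes> prod2 H b b'"
  unfolding prod3_def by (rule tensor_mult_tensor[OF prod1_bil prod2_bil])

lemma mult_tensor: "mult H (x \<otimes> y) = prod1 H x y"
  by (simp add: prod1_def)

lemma counit_form_bil:
  "cbilinear (\<lambda>y1 y2. counit H (prod1 H x y1) * counit H (prod1 H y2 z))"
  by (simp add: cbilinear_iff cbilinear_simps[OF prod1_bil] clinear_simps[OF counit_lin]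
      scaleC_complex algebra_simps)

lemmas tensor_calc =
  prod2_tensor prod3_tensor mult_tensor tensor_map_tensor tensor_assoc_tensor
  tensor_lunit_tensor tensor_runit_tensor tensor_lift_tensor[OF counit_form_bil]
  cbilinear_simps[OF tensor_cbilinear]
  cbilinear_simps[OF prod1_bil] cbilinear_simps[OF prod2_bil] cbilinear_simps[OF prod3_bil]
  clinear_simps[OF mult_lin] clinear_simps[OF comult_lin] clinear_simps[OF counit_lin]
  clinear_simps[OF antipode_lin] clinear_simps[OF clinear_tensor_map]
  clinear_simps[OF clinear_tensor_assoc] clinear_simps[OF clinear_tensor_lunit]
  clinear_simps[OF clinear_tensor_runit]
  clinear_simps[OF tensor_lift_clinear[OF counit_form_bil]]
  complex_vector.scale_one complex_vector.scale_zero_left complex_vector.scale_zero_right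

end

locale structure_with_basis = linear_structure H + basis_pair u v X Y
  for H :: "'v::complex_vector weak_hopf_data" and u v :: 'v and X Y
begin

text \<open>
  Every axiom compares two maps that are linear in each variable, so it suffices to check it on
  basis vectors, one variable at a time. In the multiplicativity of the counit only the middle
  argument, the one that is comultiplied, is specialised.
\<close>

lemma weak_hopf_algebraI_basis:
  assumes unit: "\<And>x. x \<in> {u, v} \<Longrightarrow> prod1 H (one H) x = x \<and> prod1 H x (one H) = x"
    and assoc: "\<And>x y z. \<lbrakk>x \<in> {u, v}; y \<in> {u, v}; z \<in> {u, v}\<rbrakk> \<Longrightarrow>
      prod1 H (prod1 H x y) z = prod1 H x (prod1 H y z)"
    and coassoc: "\<And>x. x \<in> {u, v} \<Longrightarrow>
      tensor_assoc (tensor_map (comult H) id (comult H x))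
        = tensor_map id (comult H) (comult H x)"
    and counit: "\<And>x. x \<in> {u, v} \<Longrightarrow>
      tensor_lunit (tensor_map (counit H) id (comult H x)) = x \<and>
      tensor_runit (tensor_map id (counit H) (comult H x)) = x"
    and comult_mult: "\<And>x y. \<lbrakk>x \<in> {u, v}; y \<in> {u, v}\<rbrakk> \<Longrightarrow>
      comult H (prod1 H x y) = prod2 H (comult H x) (comult H y)"
    and comult_one:
      "tensor_assoc (tensor_map (comult H) id (comult H (one H)))
        = prod3 H (tensor_assoc (comult H (one H) \<otimes> one H)) (one H \<otimes> comult H (one H))"
      "tensor_assoc (tensor_map (comult H) id (comult H (one H)))
        = prod3 H (one H \<otimes> comult H (one H)) (tensor_assoc (comult H (one H) \<otimes> one H))"
    and counit_mult: "\<And>x y z. y \<in> {u, v} \<Longrightarrow>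
      counit H (prod1 H (prod1 H x y) z)
        = tensor_lift (\<lambda>y1 y2. counit H (prod1 H x y1) * counit H (prod1 H y2 z)) (comult H y)"
    and antipode: "\<And>x. x \<in> {u, v} \<Longrightarrow>
      mult H (tensor_map id (antipode H) (comult H x))
        = tensor_lunit (tensor_map (counit H) id (prod2 H (comult H (one H)) (x \<otimes> one H))) \<and>
      mult H (tensor_map (antipode H) id (comult H x))
        = tensor_runit (tensor_map id (counit H) (prod2 H (one H \<otimes> x) (comult H (one H)))) \<and>
      mult H (tensor_map (mult H) id
            (tensor_map (tensor_map (antipode H) id) (antipode H)
              (tensor_map (comult H) id (comult H x)))) = antipode H x"
  shows "weak_hopf_algebra H"
proof -
  have unit1: "prod1 H (one H) x = x" for x
    by (rule eq_on_basis[where f = "\<lambda>x. prod1 H (one H) x" and g = "\<lambda>x. x"],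
        (rule clinearI; simp add: tensor_calc)+, use unit in blast)
  have unit2: "prod1 H x (one H) = x" for x
    by (rule eq_on_basis[where f = "\<lambda>x. prod1 H x (one H)" and g = "\<lambda>x. x"],
        (rule clinearI; simp add: tensor_calc)+, use unit in blast)
  have assoc1: "prod1 H (prod1 H x y) z = prod1 H x (prod1 H y z)"
    if "x \<in> {u, v}" "y \<in> {u, v}" for x y z
    by (rule eq_on_basis[where f = "\<lambda>z. prod1 H (prod1 H x y) z" and g = "\<lambda>z. prod1 H x (prod1 H y z)"],
        (rule clinearI; simp add: tensor_calc)+, use that assoc in blast)
  have assoc2: "prod1 H (prod1 H x y) z = prod1 H x (prod1 H y z)"
    if "x \<in> {u, v}" for x y z
    by (rule eq_on_basis[where f = "\<lambda>y. prod1 H (prod1 H x y) z" and g = "\<lambda>y. prod1 H x (prod1 H y z)"],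
        (rule clinearI; simp add: tensor_calc)+, use that assoc1 in blast)
  have assoc': "prod1 H (prod1 H x y) z = prod1 H x (prod1 H y z)" for x y z
    by (rule eq_on_basis[where f = "\<lambda>x. prod1 H (prod1 H x y) z" and g = "\<lambda>x. prod1 H x (prod1 H y z)"],
        (rule clinearI; simp add: tensor_calc)+, use assoc2 in blast)
  have coassoc': "tensor_assoc (tensor_map (comult H) id (comult H x))
        = tensor_map id (comult H) (comult H x)" for x
    by (rule eq_on_basis[where f = "\<lambda>x. tensor_assoc (tensor_map (comult H) id (comult H x))"
          and g = "\<lambda>x. tensor_map id (comult H) (comult H x)"],
        (rule clinearI; simp add: tensor_calc)+, use coassoc in blast)
  have counit1: "tensor_lunit (tensor_map (counit H) id (comult H x)) = x" for x
    by (rule eq_on_basis[where f = "\<lambda>x. tensor_lunit (tensor_map (counit H) id (comult H x))"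
          and g = "\<lambda>x. x"],
        (rule clinearI; simp add: tensor_calc)+, use counit in blast)
  have counit2: "tensor_runit (tensor_map id (counit H) (comult H x)) = x" for x
    by (rule eq_on_basis[where f = "\<lambda>x. tensor_runit (tensor_map id (counit H) (comult H x))"
          and g = "\<lambda>x. x"],
        (rule clinearI; simp add: tensor_calc)+, use counit in blast)
  have cm1: "comult H (prod1 H x y) = prod2 H (comult H x) (comult H y)"
    if "x \<in> {u, v}" for x y
    by (rule eq_on_basis[where f = "\<lambda>y. comult H (prod1 H x y)"
          and g = "\<lambda>y. prod2 H (comult H x) (comult H y)"],
        (rule clinearI; simp add: tensor_calc)+, use that comult_mult in blast)
  have cm2: "comult H (prod1 H x y) = prod2 H (comult H x) (comult H y)" for x y
    by (rule eq_on_basis[where f = "\<lambda>x. comult H (prod1 H x y)"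
          and g = "\<lambda>x. prod2 H (comult H x) (comult H y)"],
        (rule clinearI; simp add: tensor_calc)+, use cm1 in blast)
  have counit_mult': "counit H (prod1 H (prod1 H x y) z)
      = tensor_lift (\<lambda>y1 y2. counit H (prod1 H x y1) * counit H (prod1 H y2 z)) (comult H y)"
    for x y z
    by (rule eq_on_basis[where f = "\<lambda>y. counit H (prod1 H (prod1 H x y) z)" and g = "\<lambda>y.
          tensor_lift (\<lambda>y1 y2. counit H (prod1 H x y1) * counit H (prod1 H y2 z)) (comult H y)"],
        (rule clinearI; simp add: tensor_calc)+, use counit_mult in blast)
  have antipode1: "mult H (tensor_map id (antipode H) (comult H x))
      = tensor_lunit (tensor_map (counit H) id (prod2 H (comult H (one H)) (x \<otimes> one H)))" for x
    by (rule eq_on_basis[where f = "\<lambda>x. mult H (tensor_map id (antipode H) (comult H x))" and g = "\<lambda>x.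
          tensor_lunit (tensor_map (counit H) id (prod2 H (comult H (one H)) (x \<otimes> one H)))"],
        (rule clinearI; simp add: tensor_calc)+, use antipode in blast)
  have antipode2: "mult H (tensor_map (antipode H) id (comult H x))
      = tensor_runit (tensor_map id (counit H) (prod2 H (one H \<otimes> x) (comult H (one H))))" for x
    by (rule eq_on_basis[where f = "\<lambda>x. mult H (tensor_map (antipode H) id (comult H x))" and g = "\<lambda>x.
          tensor_runit (tensor_map id (counit H) (prod2 H (one H \<otimes> x) (comult H (one H))))"],
        (rule clinearI; simp add: tensor_calc)+, use antipode in blast)
  have antipode3: "mult H (tensor_map (mult H) id
            (tensor_map (tensor_map (antipode H) id) (antipode H)
              (tensor_map (comult H) id (comult H x)))) = antipode H x" for x
    by (rule eq_on_basis[where f = "\<lambda>x. mult H (tensor_map (mult H) id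
            (tensor_map (tensor_map (antipode H) id) (antipode H)
              (tensor_map (comult H) id (comult H x))))" and g = "antipode H"],
        (rule clinearI; simp add: tensor_calc)+, use antipode in blast)
  show ?thesis
    unfolding weak_hopf_algebra_def weak_bialgebra_def unital_assoc_algebra_def
      counital_coassoc_coalgebra_def
    using unit_lin unit1 unit2 assoc' coassoc' counit1 counit2 cm2 comult_one counit_mult'
      antipode1 antipode2 antipode3 by simp
qed

lemma lunit_counit_ten2:
  "tensor_lunit (tensor_map (counit H) id (ten2 a b c d))
     = vec2 (counit H u * a + counit H v * c) (counit H u * b + counit H v * d)"
  by (simp add: ten2_def vec2_def tensor_calc complex_vector.scale_left_distrib
      add_ac mult_ac)

lemma runit_counit_ten2:
  "tensor_runit (tensor_map id (counit H) (ten2 a b c d))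
     = vec2 (counit H u * a + counit H v * b) (counit H u * c + counit H v * d)"
  by (simp add: ten2_def vec2_def tensor_calc complex_vector.scale_left_distrib
      add_ac mult_ac)

lemma mult_antipode_ten2:
  "mult H (tensor_map id (antipode H) (ten2 a b c d))
     = a *\<^sub>C prod1 H u (antipode H u) + b *\<^sub>C prod1 H u (antipode H v)
       + c *\<^sub>C prod1 H v (antipode H u) + d *\<^sub>C prod1 H v (antipode H v)"
  by (simp add: ten2_def tensor_calc)

end

text \<open>
  A linear map that matches two bases is bijective, and its compatibility with the operations can be
  read off from the structure constants.
\<close>

lemma weak_hopf_isoI_basis:
  fixes H :: "'v::complex_vector weak_hopf_data" and K :: "'w::complex_vector weak_hopf_data"
  assumes "structure_with_basis H u v X Y" "structure_with_basis K p q X' Y'"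
    and f: "clinear f" "f u = p" "f v = q"
    and mult: "\<And>x y. \<lbrakk>x \<in> {u, v}; y \<in> {u, v}\<rbrakk> \<Longrightarrow> f (prod1 H x y) = prod1 K (f x) (f y)"
    and comult: "\<And>x. x \<in> {u, v} \<Longrightarrow> tensor_map f f (comult H x) = comult K (f x)"
    and counit: "\<And>x. x \<in> {u, v} \<Longrightarrow> counit K (f x) = counit H x"
    and antipode: "\<And>x. x \<in> {u, v} \<Longrightarrow> f (antipode H x) = antipode K (f x)"
  shows "weak_hopf_iso H K"
proof -
  interpret H: structure_with_basis H u v X Y by fact
  interpret K: structure_with_basis K p q X' Y' by fact
  note lin = H.tensor_calc K.tensor_calc clinear_simps[OF f(1)]
    clinear_simps[OF clinear_tensor_map[OF f(1) f(1)]]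
  define g where "g y = X' y *\<^sub>C u + Y' y *\<^sub>C v" for y
  have g: "clinear g"
    by (rule clinearI) (simp_all add: g_def complex_vector.scale_left_distrib
        complex_vector.scale_right_distrib add_ac)
  have "g (f x) = x" for x
    by (rule H.eq_on_basis[where f = "\<lambda>x. g (f x)" and g = "\<lambda>x. x"],
        (rule clinearI; simp add: lin clinear_simps[OF g])+)
       (auto simp: f g_def)
  moreover have "f (g y) = y" for y
    by (rule K.eq_on_basis[where f = "\<lambda>y. f (g y)" and g = "\<lambda>y. y"],
        (rule clinearI; simp add: lin clinear_simps[OF g])+)
       (auto simp: f g_def lin)
  ultimately have bij: "bij f" by (intro o_bij[of g]) (auto simp: fun_eq_iff)
  have mult1: "f (prod1 H x y) = prod1 K (f x) (f y)" if "x \<in> {u, v}" for x y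
    by (rule H.eq_on_basis[where f = "\<lambda>y. f (prod1 H x y)" and g = "\<lambda>y. prod1 K (f x) (f y)"],
        (rule clinearI; simp add: lin)+, use that mult in blast)
  have mult2: "f (prod1 H x y) = prod1 K (f x) (f y)" for x y
    by (rule H.eq_on_basis[where f = "\<lambda>x. f (prod1 H x y)" and g = "\<lambda>x. prod1 K (f x) (f y)"],
        (rule clinearI; simp add: lin)+, use mult1 in blast)
  have "(\<lambda>t. f (mult H t)) = (\<lambda>t. mult K (tensor_map f f t))"
    by (rule clinear_tensor_eqI)
       (rule clinearI; simp add: lin | simp add: lin mult2 tensor_map_tensor f(1))+
  then have "f (mult H t) = mult K (tensor_map f f t)" for t
    by meson
  moreover have "tensor_map f f (comult H x) = comult K (f x)" for x
    by (rule H.eq_on_basis[where f = "\<lambda>x. tensor_map f f (comult H x)"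
          and g = "\<lambda>x. comult K (f x)"],
        (rule clinearI; simp add: lin)+, use comult in blast)
  moreover have "counit K (f x) = counit H x" for x
    by (rule H.eq_on_basis[where f = "\<lambda>x. counit K (f x)"
          and g = "counit H"],
        (rule clinearI; simp add: lin)+, use counit in blast)
  moreover have "f (antipode H x) = antipode K (f x)" for x
    by (rule H.eq_on_basis[where f = "\<lambda>x. f (antipode H x)"
          and g = "\<lambda>x. antipode K (f x)"],
        (rule clinearI; simp add: lin)+, use antipode in blast)
  ultimately show ?thesis unfolding weak_hopf_iso_def using f(1) bij by blast
qed

section \<open>The algebra of functions on two points\<close>

locale idempotent_basis = structure_with_basis +
  assumes mult_table [simp]: "prod1 H u u = u" "prod1 H u v = 0" "prod1 H v u = 0" "prod1 H v v = v"
    and one_eq: "one H = u + v"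
begin

lemma prod1_basis:
  "prod1 H x u = X x *\<^sub>C u" "prod1 H u x = X x *\<^sub>C u"
  "prod1 H x v = Y x *\<^sub>C v" "prod1 H v x = Y x *\<^sub>C v"
  by (subst expand[of x]; simp add: tensor_calc)+

lemma swap: "idempotent_basis H v u Y X"
proof -
  have "basis_pair v u Y X"
    by (rule basis_pair.intro) (simp_all add: X_lin Y_lin, subst add.commute, rule expand)
  then show ?thesis
    using linear_structure_axioms one_eq
    by (simp add: idempotent_basis_def structure_with_basis_def idempotent_basis_axioms_def add.commute)
qed

end

text \<open>
  The functions on the groupoid with two objects and no arrows besides the identities, whose delta
  functions are \<open>u\<close> and \<open>v\<close>.
\<close>

definition discrete_table :: "'v::complex_vector weak_hopf_data \<Rightarrow> 'v \<Rightarrow> 'v \<Rightarrow> bool" where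
  "discrete_table H u v \<longleftrightarrow>
     comult H u = u \<otimes> u \<and> comult H v = v \<otimes> v \<and> counit H u = 1 \<and> counit H v = 1 \<and>
     antipode H u = u \<and> antipode H v = v"

text \<open>
  The functions on the group of order two, where \<open>u\<close> is the delta function at the identity:
  \<open>\<Delta>\<close> sends a delta function to the sum over all factorisations of its point.
\<close>

definition cyclic_table :: "'v::complex_vector weak_hopf_data \<Rightarrow> 'v \<Rightarrow> 'v \<Rightarrow> bool" where
  "cyclic_table H u v \<longleftrightarrow>
     comult H u = u \<otimes> u + v \<otimes> v \<and> comult H v = u \<otimes> v + v \<otimes> u \<and>
     counit H u = 1 \<and> counit H v = 0 \<and> antipode H u = u \<and> antipode H v = v"

lemma (in idempotent_basis) weak_hopf_algebra_if_discrete: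
  assumes "discrete_table H u v"
  shows "weak_hopf_algebra H"
proof -
  note table = assms[unfolded discrete_table_def]
  show ?thesis
    by (rule weak_hopf_algebraI_basis)
      (auto simp: table prod1_basis tensor_calc one_eq scaleC_complex algebra_simps)
qed

lemma (in idempotent_basis) weak_hopf_algebra_if_cyclic:
  assumes "cyclic_table H u v"
  shows "weak_hopf_algebra H"
proof -
  note table = assms[unfolded cyclic_table_def]
  show ?thesis
    by (rule weak_hopf_algebraI_basis)
      (auto simp: table prod1_basis tensor_calc one_eq scaleC_complex algebra_simps)
qed

lemma idempotent_basis_iso:
  assumes "idempotent_basis H u v X Y" "idempotent_basis K p q X' Y'"
    and tables: "discrete_table H u v \<and> discrete_table K p q \<or> cyclic_table H u v \<and> cyclic_table K p q"
  shows "weak_hopf_iso H K"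
proof -
  interpret H: idempotent_basis H u v X Y by fact
  interpret K: idempotent_basis K p q X' Y' by fact
  define f where "f x = X x *\<^sub>C p + Y x *\<^sub>C q" for x
  have lin: "clinear f"
    by (rule clinearI) (simp_all add: f_def complex_vector.scale_left_distrib
        complex_vector.scale_right_distrib add_ac)
  have f: "f u = p" "f v = q"
    by (simp_all add: f_def)
  show ?thesis
    by (rule weak_hopf_isoI_basis[OF H.structure_with_basis_axioms K.structure_with_basis_axioms lin f])
      (use tables in \<open>auto simp: f discrete_table_def cyclic_table_def tensor_map_tensor lin
          clinear_simps[OF lin] clinear_simps[OF clinear_tensor_map[OF lin lin]]\<close>)
qed

section \<open>Weak Hopf structures on the functions on two points\<close>

text \<open>
  Here \<open>a\<^sub>1, \<dots>, a\<^sub>4\<close> and \<open>b\<^sub>1, \<dots>, b\<^sub>4\<close> are the coefficients of \<open>\<Delta>(u)\<close> and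
  \<open>\<Delta>(v)\<close> at \<open>u \<otimes> u\<close>, \<open>u \<otimes> v\<close>, \<open>v \<otimes> u\<close>, \<open>v \<otimes> v\<close>, the numbers \<open>\<alpha>\<close>, \<open>\<beta>\<close>
  are the counits of \<open>u\<close>, \<open>v\<close>, and \<open>(s\<^sub>1, s\<^sub>2)\<close>, \<open>(t\<^sub>1, t\<^sub>2)\<close> are the coordinates of
  their antipodes. Comparing the left with the right counit law shows that the partial product on
  the two points is commutative; the cases are then the value of the mixed product: undefined,
  \<open>u\<close> or \<open>v\<close>. In the last two cases the mixed product makes the other point an identity, and
  the antipode equation forces the square of the non-identity point to be
  the identity. In the undefined case the equations leave \<open>s\<^sub>2\<close>
  and \<open>t\<^sub>1\<close> free.
\<close>

lemma two_point_structure_constants: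
  fixes a1 a2 a3 a4 b1 b2 b3 b4 \<alpha> \<beta> s1 s2 t1 t2 :: complex
  assumes idem: "a1 * a1 = a1" "a2 * a2 = a2" "a3 * a3 = a3" "a4 * a4 = a4"
      "b1 * b1 = b1" "b2 * b2 = b2" "b3 * b3 = b3" "b4 * b4 = b4"
    and orth: "a1 * b1 = 0" "a2 * b2 = 0" "a3 * b3 = 0" "a4 * b4 = 0"
    and left: "\<alpha> * a1 + \<beta> * a3 = 1" "\<alpha> * a2 + \<beta> * a4 = 0"
      "\<alpha> * b1 + \<beta> * b3 = 0" "\<alpha> * b2 + \<beta> * b4 = 1"
    and right: "\<alpha> * a1 + \<beta> * a2 = 1" "\<alpha> * a3 + \<beta> * a4 = 0"
      "\<alpha> * b1 + \<beta> * b2 = 0" "\<alpha> * b3 + \<beta> * b4 = 1"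
    and anti: "a1 * s1 + a2 * t1 = \<alpha> * (a1 + b1)" "a3 * s2 + a4 * t2 = \<alpha> * (a2 + b2)"
      "b1 * s1 + b2 * t1 = \<beta> * (a3 + b3)" "b3 * s2 + b4 * t2 = \<beta> * (a4 + b4)"
  shows "(a1, a2, a3, a4, b1, b2, b3, b4, \<alpha>, \<beta>) = (1, 0, 0, 0, 0, 0, 0, 1, 1, 1) \<and> s1 = 1 \<and> t2 = 1 \<or>
    (a1, a2, a3, a4, b1, b2, b3, b4, \<alpha>, \<beta>) = (1, 0, 0, 1, 0, 1, 1, 0, 1, 0) \<and>
      (s1, s2, t1, t2) = (1, 0, 0, 1) \<or>
    (a1, a2, a3, a4, b1, b2, b3, b4, \<alpha>, \<beta>) = (0, 1, 1, 0, 1, 0, 0, 1, 0, 1) \<and>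
      (s1, s2, t1, t2) = (1, 0, 0, 1)"
proof -
  have bit: "x = 0 \<or> x = 1" if "x * x = x" for x :: complex
    using that by simp
  have "\<alpha> \<noteq> 0 \<or> \<beta> \<noteq> 0" using left(1) by auto
  moreover have "\<beta> * a3 = \<beta> * a2" "\<beta> * b3 = \<beta> * b2"
    using left(1,3) right(1,3) by (metis add_left_cancel)+
  moreover have "\<alpha> * a3 = \<alpha> * a2" "\<alpha> * b3 = \<alpha> * b2"
    using left(2,4) right(2,4) by (metis add_right_cancel)+
  ultimately have sym: "a3 = a2" "b3 = b2" by auto
  consider "a2 = 0" "b2 = 0" | "a2 = 1" | "b2 = 1"
    using bit[OF idem(2)] bit[OF idem(6)] by blast
  then show ?thesis
  proof cases
    case 1
    then have v: "a3 = 0" "b3 = 0" using sym by simp_all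
    have "a1 = 1" "b4 = 1" using bit[OF idem(1)] bit[OF idem(8)] left(1,4) 1 v by auto
    moreover from this have "b1 = 0" "a4 = 0" "\<alpha> = 1" "\<beta> = 1" using orth left(1,4) 1 v by simp_all
    ultimately show ?thesis using 1 v anti(1,4) by simp
  next
    case 2
    then have v: "b2 = 0" "a3 = 1" "b3 = 0" using orth(2) sym by simp_all
    have "b4 = 1" "\<beta> = 1" using left(4) bit[OF idem(8)] v by auto
    moreover from this have "a4 = 0" using orth(4) by simp
    moreover from this have "\<alpha> = 0" using left(2) 2 by simp
    ultimately have w: "b4 = 1" "\<beta> = 1" "a4 = 0" "\<alpha> = 0" .
    have "b1 = 1" using anti(3) bit[OF idem(5)] v w by auto
    moreover from this have "a1 = 0" using orth(1) by simp
    ultimately show ?thesis using 2 v w anti by simp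
  next
    case 3
    then have v: "a2 = 0" "b3 = 1" "a3 = 0" using orth(2) sym by simp_all
    have "a1 = 1" "\<alpha> = 1" using right(1) bit[OF idem(1)] v by auto
    moreover from this have "b1 = 0" using orth(1) by simp
    moreover from this have "\<beta> = 0" using right(3) 3 by simp
    ultimately have w: "a1 = 1" "\<alpha> = 1" "b1 = 0" "\<beta> = 0" .
    have "a4 = 1" using anti(2) bit[OF idem(4)] 3 v w by auto
    moreover from this have "b4 = 0" using orth(4) by simp
    ultimately show ?thesis using 3 v w anti by simp
  qed
qed

lemma weak_hopf_algebraD:
  assumes "weak_hopf_algebra H"
  shows "linear_structure H"
    and "prod1 H (one H) x = x" "prod1 H x (one H) = x"
    and "comult H (prod1 H x y) = prod2 H (comult H x) (comult H y)"
    and "tensor_lunit (tensor_map (counit H) id (comult H x)) = x"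
    and "tensor_runit (tensor_map id (counit H) (comult H x)) = x"
    and "mult H (tensor_map id (antipode H) (comult H x))
        = tensor_lunit (tensor_map (counit H) id (prod2 H (comult H (one H)) (x \<otimes> one H)))"
    and "mult H (tensor_map (mult H) id
            (tensor_map (tensor_map (antipode H) id) (antipode H)
              (tensor_map (comult H) id (comult H x)))) = antipode H x"
  using assms
  unfolding weak_hopf_algebra_def weak_bialgebra_def unital_assoc_algebra_def
    counital_coassoc_coalgebra_def linear_structure_def by blast+

context idempotent_basis
begin

lemma prod2_ten2:
  "prod2 H (ten2 a b c d) (ten2 a' b' c' d') = ten2 (a * a') (b * b') (c * c') (d * d')"
  by (simp add: ten2_def tensor_calc mult_ac)

lemma tables_if_weak_hopf_algebra:
  assumes "weak_hopf_algebra H"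
  shows "discrete_table H u v \<or> cyclic_table H u v \<or> cyclic_table H v u"
proof -
  note ax = weak_hopf_algebraD(2-)[OF assms]
  obtain a1 a2 a3 a4 where a: "comult H u = ten2 a1 a2 a3 a4" by (rule ten2_cases)
  obtain b1 b2 b3 b4 where b: "comult H v = ten2 b1 b2 b3 b4" by (rule ten2_cases)
  obtain s1 s2 where s: "antipode H u = vec2 s1 s2" by (rule vec2_cases)
  obtain t1 t2 where t: "antipode H v = vec2 t1 t2" by (rule vec2_cases)
  have coord: "X (vec2 x y) = x" "Y (vec2 x y) = y" for x y
    by (simp_all add: vec2_def)
  have zero: "0 = ten2 0 0 0 0" by (simp add: ten2_def)
  have comult_one: "comult H (one H) = ten2 (a1 + b1) (a2 + b2) (a3 + b3) (a4 + b4)"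
    by (simp add: one_eq tensor_calc a b ten2_add)
  have uv: "u \<otimes> one H = ten2 1 1 0 0" "v \<otimes> one H = ten2 0 0 1 1"
    by (simp_all add: one_eq ten2_def tensor_calc)
  have idem: "a1 * a1 = a1" "a2 * a2 = a2" "a3 * a3 = a3" "a4 * a4 = a4"
      "b1 * b1 = b1" "b2 * b2 = b2" "b3 * b3 = b3" "b4 * b4 = b4"
      "a1 * b1 = 0" "a2 * b2 = 0" "a3 * b3 = 0" "a4 * b4 = 0"
    using ax(3)[of u u] ax(3)[of v v] ax(3)[of u v]
    by (simp_all add: a b prod2_ten2 tensor_calc zero ten2_eq_iff)
  have counit: "counit H u * a1 + counit H v * a3 = 1" "counit H u * a2 + counit H v * a4 = 0"
      "counit H u * b1 + counit H v * b3 = 0" "counit H u * b2 + counit H v * b4 = 1"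
      "counit H u * a1 + counit H v * a2 = 1" "counit H u * a3 + counit H v * a4 = 0"
      "counit H u * b1 + counit H v * b2 = 0" "counit H u * b3 + counit H v * b4 = 1"
    using ax(4)[of u] ax(4)[of v] ax(5)[of u] ax(5)[of v] vec2_basis
    by (simp_all add: a b lunit_counit_ten2 runit_counit_ten2) (metis vec2_eq_iff)+
  have anti: "mult H (tensor_map id (antipode H) (ten2 a b c d))
      = vec2 (a * s1 + b * t1) (c * s2 + d * t2)" for a b c d
    by (simp add: mult_antipode_ten2 prod1_basis s t coord) (simp add: vec2_def algebra_simps)
  have antipode: "a1 * s1 + a2 * t1 = counit H u * (a1 + b1)" "a3 * s2 + a4 * t2 = counit H u * (a2 + b2)"
      "b1 * s1 + b2 * t1 = counit H v * (a3 + b3)" "b3 * s2 + b4 * t2 = counit H v * (a4 + b4)"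
    using ax(6)[of u] ax(6)[of v]
    by (simp_all add: comult_one uv prod2_ten2 a b anti lunit_counit_ten2 vec2_eq_iff)
  consider
    (discrete) "(a1, a2, a3, a4, b1, b2, b3, b4, counit H u, counit H v) = (1, 0, 0, 0, 0, 0, 0, 1, 1, 1)"
      "s1 = 1" "t2 = 1" |
    (cyclic) "(a1, a2, a3, a4, b1, b2, b3, b4, counit H u, counit H v) = (1, 0, 0, 1, 0, 1, 1, 0, 1, 0)"
      "(s1, s2, t1, t2) = (1, 0, 0, 1)" |
    (cyclic') "(a1, a2, a3, a4, b1, b2, b3, b4, counit H u, counit H v) = (0, 1, 1, 0, 1, 0, 0, 1, 0, 1)"
      "(s1, s2, t1, t2) = (1, 0, 0, 1)"
    using two_point_structure_constants[OF idem counit antipode] by blast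
  then show ?thesis
  proof cases
    case discrete
    then have comult: "comult H u = u \<otimes> u" "comult H v = v \<otimes> v"
      by (simp_all add: a b ten2_def tensor_calc)
    \<comment> \<open>The off-diagonal entries of the antipode are removed by \<open>S(u) u S(u) = S(u)\<close>, and
      likewise for \<open>v\<close>.\<close>
    have "antipode H u = u" "antipode H v = v"
      using ax(7)[of u] ax(7)[of v] discrete
      by (simp_all add: comult tensor_calc prod1_basis s t coord)
    then show ?thesis using comult discrete by (simp add: discrete_table_def)
  next
    case cyclic
    then have "cyclic_table H u v"
      by (simp add: cyclic_table_def a b s t ten2_def vec2_def tensor_calc)
    then show ?thesis by blast
  next
    case cyclic'
    then have "cyclic_table H v u"
      by (simp add: cyclic_table_def a b s t ten2_def vec2_def tensor_calc add.commute)
    then show ?thesis by blast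
  qed
qed

end

section \<open>No weak Hopf structure on the dual numbers\<close>

text \<open>
  The counit laws force \<open>\<epsilon>(v) \<noteq> 0\<close>, while the antipode axiom at \<open>v\<close> forces \<open>\<epsilon>(v) = 0\<close>.
\<close>

lemma (in structure_with_basis) not_dual_numbers:
  assumes "weak_hopf_algebra H" and one: "one H = u" and nil: "prod1 H v v = 0"
  shows False
proof -
  note ax = weak_hopf_algebraD(2-)[OF assms(1)]
  have table: "prod1 H u x = x" "prod1 H x u = x" for x
    using ax(1,2) by (simp_all add: one)
  have prod1_v: "prod1 H v x = X x *\<^sub>C v" for x
    by (subst expand[of x]) (simp add: tensor_calc table nil)
  have prod2_ten2: "prod2 H (ten2 a b c d) (ten2 a' b' c' d')
      = ten2 (a * a') (a * b' + b * a') (a * c' + c * a') (a * d' + d * a' + b * c' + c * b')"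
    for a b c d a' b' c' d'
    by (simp add: ten2_def tensor_calc table nil complex_vector.scale_left_distrib algebra_simps)
  obtain c1 c2 c3 c4 where c: "comult H u = ten2 c1 c2 c3 c4" by (rule ten2_cases)
  obtain d1 d2 d3 d4 where d: "comult H v = ten2 d1 d2 d3 d4" by (rule ten2_cases)
  have zero: "0 = ten2 0 0 0 0" by (simp add: ten2_def)
  have counit: "counit H u * c1 + counit H v * c3 = 1"
      "counit H u * d1 + counit H v * d3 = 0" "counit H u * d2 + counit H v * d4 = 1"
      "counit H u * d1 + counit H v * d2 = 0" "counit H u * d3 + counit H v * d4 = 1"
    using ax(4)[of u] ax(4)[of v] ax(5)[of v] vec2_basis
    by (simp_all add: c d lunit_counit_ten2 runit_counit_ten2) (metis vec2_eq_iff)+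
  have c_idem: "c1 * c1 = c1" "c1 * c2 + c2 * c1 = c2" "c1 * c3 + c3 * c1 = c3"
      "c1 * c4 + c4 * c1 + c2 * c3 + c3 * c2 = c4"
    using ax(3)[of u u] by (simp_all add: table c prod2_ten2 ten2_eq_iff)
  \<comment> \<open>A vanishing leading coefficient would make the idempotent \<open>\<Delta>(1)\<close> nilpotent, hence zero,
    against the counit law.\<close>
  have "c1 \<noteq> 0" using c_idem counit(1) by auto
  then have c_eq: "c1 = 1" "c2 = 0" "c3 = 0" "c4 = 0"
    using c_idem by auto
  then have counit_u: "counit H u = 1" using counit(1) by simp
  have "ten2 0 0 0 0 = prod2 H (comult H v) (comult H v)"
    using ax(3)[of v v] by (simp add: nil tensor_calc zero)
  then have sq: "d1 * d1 = 0" "d1 * d4 + d4 * d1 + d2 * d3 + d3 * d2 = 0"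
    unfolding d prod2_ten2 ten2_eq_iff by (metis, metis)
  then have "d1 = 0" by simp
  moreover from this have "d2 * d3 = 0" using sq(2) by simp
  moreover have "d2 + counit H v * d4 = d3 + counit H v * d4"
    using counit(3,5) by (simp only: counit_u mult_1_left)
  ultimately have d_eq: "d1 = 0" "d2 = 0" "d3 = 0" by auto
  have "v \<otimes> one H = ten2 0 0 1 0" by (simp add: one ten2_def tensor_calc)
  then have "vec2 (counit H v) 0 = d4 *\<^sub>C X (antipode H v) *\<^sub>C v"
    using ax(6)[of v] c_eq d_eq
    by (simp add: d c one prod2_ten2 lunit_counit_ten2 mult_antipode_ten2 prod1_v tensor_calc)
  also have "\<dots> = vec2 0 (d4 * X (antipode H v))"
    by (simp add: vec2_def)
  finally have "counit H v = 0" by (simp add: vec2_eq_iff)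
  then show False using counit(3) d_eq by simp
qed

section \<open>Classification\<close>

text \<open>
  If \<open>x\<^sup>2 = s \<cdot> 1 + t \<cdot> x\<close>, then \<open>y = x - t/2 \<cdot> 1\<close> has square \<open>d \<cdot> 1\<close> with
  \<open>d = s + t\<^sup>2/4\<close>. For \<open>d \<noteq> 0\<close> the idempotents are \<open>(1 \<plusminus> y / \<surd>d) / 2\<close>.
\<close>

lemma exists_idempotent_basis:
  fixes H :: "'v::complex_vector weak_hopf_data"
  assumes dim: "complex_vector.dim (UNIV :: 'v set) = 2" and H: "weak_hopf_algebra H"
  shows "\<exists>p q X Y. idempotent_basis H p q X Y"
proof -
  note unit = weak_hopf_algebraD(2,3)[OF H]
  interpret linear_structure H by (rule weak_hopf_algebraD(1)[OF H])
  have "one H \<noteq> 0"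
  proof
    assume "one H = 0"
    then have "x = 0" for x :: 'v
      using unit(1)[of x] by (simp add: tensor_calc)
    then have "complex_vector.span {} = complex_vector.span (UNIV :: 'v set)" by auto
    then have "complex_vector.dim (UNIV :: 'v set) = card ({} :: 'v set)"
      by (rule complex_vector.dim_eq_card) (rule complex_vector.independent_empty)
    then show False using dim by simp
  qed
  then obtain x X Y where "basis_pair (one H) x X Y"
    using exists_basis_pair[OF dim] by blast
  then interpret basis_pair "one H" x X Y .
  obtain s t where st: "prod1 H x x = vec2 s t" by (rule vec2_cases)
  have prod1_vec2: "prod1 H (vec2 a b) (vec2 a' b')
      = vec2 (a * a' + b * b' * s) (a * b' + b * a' + b * b' * t)" for a b a' b'
    by (simp add: vec2_def tensor_calc unit st[unfolded vec2_def] complex_vector.scale_left_distrib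
        complex_vector.scale_right_distrib algebra_simps)
  have one: "one H = vec2 1 0" by (rule vec2_basis)
  define d where "d = s + t\<^sup>2 / 4"
  show ?thesis
  proof (cases "d = 0")
    case True
    interpret y: basis_pair "vec2 1 0" "vec2 (- t / 2) 1"
      "\<lambda>z. (1 * X z - (- t / 2) * Y z) / (1 * 1 - 0 * (- t / 2))"
      "\<lambda>z. (1 * Y z - 0 * X z) / (1 * 1 - 0 * (- t / 2))"
      by (rule change_basis) simp
    interpret y: structure_with_basis H "vec2 1 0" "vec2 (- t / 2) 1"
      "\<lambda>z. (1 * X z - (- t / 2) * Y z) / (1 * 1 - 0 * (- t / 2))"
      "\<lambda>z. (1 * Y z - 0 * X z) / (1 * 1 - 0 * (- t / 2))" ..
    have "prod1 H (vec2 (- t / 2) 1) (vec2 (- t / 2) 1) = vec2 d 0"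
      by (simp add: prod1_vec2 d_def power2_eq_square add.commute)
    also have "\<dots> = 0" using True by (simp add: vec2_def)
    finally show ?thesis using y.not_dual_numbers[OF H one] by blast
  next
    case False
    \<comment> \<open>With \<open>k = 1 / (2 \<surd>d)\<close> the idempotents are \<open>1/2 \<plusminus> k y\<close>, so their coordinates
      and all equations between them are polynomial in \<open>k\<close> and \<open>t\<close>.\<close>
    define k where "k = 1 / (2 * csqrt d)"
    have "csqrt d * csqrt d = d" by (simp flip: power2_eq_square)
    then have kd: "4 * (k * k * d) = 1"
      using False by (simp add: k_def)
    have "k * k * s = 4 * (k * k * d) / 4 - k * k * t * t / 4"
      by (simp add: d_def power2_eq_square algebra_simps)
    then have k: "k * k * s = 1/4 - k * k * t * t / 4" unfolding kd .
    define p1 p2 q1 q2 where "p1 = 1/2 - k * t / 2" and "p2 = k"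
      and "q1 = 1/2 + k * t / 2" and "q2 = - k"
    note pq_defs = p1_def p2_def q1_def q2_def
    have s: "p2 * p2 * s = 1/4 - k * k * t * t / 4" "p2 * q2 * s = - (1/4 - k * k * t * t / 4)"
      "q2 * p2 * s = - (1/4 - k * k * t * t / 4)" "q2 * q2 * s = 1/4 - k * k * t * t / 4"
      using k by (simp_all add: pq_defs)
    have zero: "0 = vec2 0 0" by (simp add: vec2_def)
    have mults: "prod1 H (vec2 p1 p2) (vec2 p1 p2) = vec2 p1 p2"
      "prod1 H (vec2 p1 p2) (vec2 q1 q2) = 0" "prod1 H (vec2 q1 q2) (vec2 p1 p2) = 0"
      "prod1 H (vec2 q1 q2) (vec2 q1 q2) = vec2 q1 q2"
      unfolding prod1_vec2 s zero vec2_eq_iff by (simp_all add: pq_defs algebra_simps)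
    have sum: "one H = vec2 p1 p2 + vec2 q1 q2"
      by (rule coord_eqI) (simp_all add: vec2_def pq_defs)
    have "p1 * q2 - p2 * q1 = - k"
      by (simp add: pq_defs algebra_simps)
    then have "p1 * q2 - p2 * q1 \<noteq> 0" using kd by auto
    then have "basis_pair (vec2 p1 p2) (vec2 q1 q2)
        (\<lambda>z. (q2 * X z - q1 * Y z) / (p1 * q2 - p2 * q1)) (\<lambda>z. (p1 * Y z - p2 * X z) / (p1 * q2 - p2 * q1))"
      by (rule change_basis)
    then have "idempotent_basis H (vec2 p1 p2) (vec2 q1 q2)
        (\<lambda>z. (q2 * X z - q1 * Y z) / (p1 * q2 - p2 * q1)) (\<lambda>z. (p1 * Y z - p2 * X z) / (p1 * q2 - p2 * q1))"
      using linear_structure_axioms mults sum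
      by (simp add: idempotent_basis_def structure_with_basis_def idempotent_basis_axioms_def)
    then show ?thesis by blast
  qed
qed

section \<open>The two structures on \<open>\<A>\<close>\<close>

lemma basis_pair_A: "basis_pair e2 (e1 - e2) (\<lambda>z. z $ 1 + z $ 2) (\<lambda>z. z $ 1)"
proof (rule basis_pair.intro)
  show "z = (z $ 1 + z $ 2) *\<^sub>C e2 + (z $ 1) *\<^sub>C (e1 - e2)" for z :: "complex^2"
    by (simp add: vec_eq_iff forall_2 scaleC_vec_def scaleC_complex axis_def algebra_simps)
qed (simp_all add: clinear_iff scaleC_vec_def scaleC_complex axis_def algebra_simps)

lemma idempotent_basis_A:
  assumes "H \<in> {weak_hopf_1, weak_hopf_2}"
  shows "idempotent_basis H e2 (e1 - e2) (\<lambda>z. z $ 1 + z $ 2) (\<lambda>z. z $ 1)"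
proof -
  have "clinear A_mult" unfolding A_mult_def by (rule tensor_lift_clinear[OF A_mult_cbilinear])
  moreover have "clinear A_unit"
    by (simp add: clinear_iff A_unit_def scaleC_complex complex_vector.scale_left_distrib)
  ultimately have "linear_structure H"
    using assms by (auto simp: linear_structure_def weak_hopf_1_def weak_hopf_2_def lin_ext_clinear)
  moreover have "prod1 H x y = lin_ext (lin_ext e1 e2 y) (lin_ext e2 e2 y) x" for x y
    using assms by (auto simp: prod1_def weak_hopf_1_def weak_hopf_2_def A_mult_def
        tensor_lift_tensor[OF A_mult_cbilinear])
  then have "prod1 H e2 e2 = e2" "prod1 H e2 (e1 - e2) = 0" "prod1 H (e1 - e2) e2 = 0"
    "prod1 H (e1 - e2) (e1 - e2) = e1 - e2"
    by (simp_all add: lin_ext_def vec_eq_iff forall_2 scaleC_vec_def scaleC_complex axis_def)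
  moreover have "one H = e2 + (e1 - e2)"
    using assms by (auto simp: one_def weak_hopf_1_def weak_hopf_2_def A_unit_def complex_vector.scale_one)
  ultimately show ?thesis
    using basis_pair_A
    by (simp add: idempotent_basis_def structure_with_basis_def idempotent_basis_axioms_def)
qed

lemma lin_ext_diff: "lin_ext a b (e1 - e2) = a - b"
  by (simp add: lin_ext_def axis_def complex_vector.scale_one)

text \<open>
  The coproduct of \<open>e\<^sub>1 - e\<^sub>2\<close> is a difference of tensors; it becomes the sum of the mixed terms
  after \<open>e\<^sub>1 \<otimes> e\<^sub>1\<close> is expanded along \<open>e\<^sub>1 = e\<^sub>2 + (e\<^sub>1 - e\<^sub>2)\<close>.
\<close>

lemma cyclic_table_1: "cyclic_table weak_hopf_1 e2 (e1 - e2)"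
proof -
  have square: "(x + y) \<otimes> (x + y) = (x \<otimes> y + y \<otimes> x) + (y \<otimes> y + x \<otimes> x)"
    for x y :: "complex^2"
    by (simp add: tensor_bilinear_simps ac_simps)
  have "e1 \<otimes> e1 = (e2 \<otimes> (e1 - e2) + (e1 - e2) \<otimes> e2) + ((e1 - e2) \<otimes> (e1 - e2) + e2 \<otimes> e2)"
    using square[of e2 "e1 - e2"] by simp
  then have "e1 \<otimes> e1 - ((e1 - e2) \<otimes> (e1 - e2) + e2 \<otimes> e2) = e2 \<otimes> (e1 - e2) + (e1 - e2) \<otimes> e2"
    by simp
  then show ?thesis
    by (simp add: cyclic_table_def weak_hopf_1_def lin_ext_e lin_ext_diff add.commute)
qed

lemma discrete_table_2: "discrete_table weak_hopf_2 e2 (e1 - e2)"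
  by (simp add: discrete_table_def weak_hopf_2_def lin_ext_e lin_ext_diff)

text \<open>
  An isomorphism is not required to preserve the unit, but it does so because it is multiplicative
  and surjective. The counit of the unit is 1 in one structure and 2 in the other.
\<close>

lemma not_iso_1_2: "\<not> weak_hopf_iso weak_hopf_1 weak_hopf_2"
proof
  assume "weak_hopf_iso weak_hopf_1 weak_hopf_2"
  then obtain f where f: "clinear f" "bij f"
    "\<And>t. f (mult weak_hopf_1 t) = mult weak_hopf_2 (tensor_map f f t)"
    "\<And>x. counit weak_hopf_2 (f x) = counit weak_hopf_1 x"
    unfolding weak_hopf_iso_def by blast
  interpret K: idempotent_basis weak_hopf_2 e2 "e1 - e2" "\<lambda>z. z $ 1 + z $ 2" "\<lambda>z. z $ 1"
    by (rule idempotent_basis_A) simp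
  have unit: "prod1 weak_hopf_1 e1 x = x" "prod1 weak_hopf_2 x e1 = x" for x
    using weak_hopf_algebraD(2)[OF idempotent_basis.weak_hopf_algebra_if_cyclic[OF
          idempotent_basis_A[OF insertI1] cyclic_table_1], of x]
      weak_hopf_algebraD(3)[OF K.weak_hopf_algebra_if_discrete[OF discrete_table_2], of x]
    by (auto simp: one_def weak_hopf_1_def weak_hopf_2_def A_unit_def complex_vector.scale_one)
  obtain x where x: "f x = e1" using f(2) by (metis bij_pointE)
  have "f e1 = prod1 weak_hopf_2 (f e1) (f x)" by (simp add: x unit)
  also have "\<dots> = f (prod1 weak_hopf_1 e1 x)"
    by (simp add: prod1_def f(1,3) tensor_map_tensor)
  also have "\<dots> = e1" by (simp add: x unit)
  finally show False
    using f(4)[of e1] by (simp add: weak_hopf_1_def weak_hopf_2_def lin_ext_e)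
qed

theorem proposition4p4:
  shows "complex_vector.dim (UNIV :: (complex^2) set) = 2
    \<and> weak_hopf_algebra weak_hopf_1
    \<and> weak_hopf_algebra weak_hopf_2
    \<and> \<not> weak_hopf_iso weak_hopf_1 weak_hopf_2
    \<and> (\<forall>H :: 'v::complex_vector weak_hopf_data.
         complex_vector.dim (UNIV :: 'v set) = 2 \<and> weak_hopf_algebra H
         \<longrightarrow> weak_hopf_iso H weak_hopf_1 \<or> weak_hopf_iso H weak_hopf_2)"
proof (intro conjI allI impI)
  note A = idempotent_basis_A[OF insertI1] idempotent_basis_A[OF insertI2[OF singletonI]]
  show "complex_vector.dim (UNIV :: (complex^2) set) = 2"
    by (rule basis_pair.dim_UNIV_eq_2[OF basis_pair_A])
  show "weak_hopf_algebra weak_hopf_1"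
    using idempotent_basis.weak_hopf_algebra_if_cyclic[OF A(1)] cyclic_table_1 by blast
  show "weak_hopf_algebra weak_hopf_2"
    using idempotent_basis.weak_hopf_algebra_if_discrete[OF A(2)] discrete_table_2 by blast
  show "\<not> weak_hopf_iso weak_hopf_1 weak_hopf_2" by (rule not_iso_1_2)
  fix H :: "'v weak_hopf_data"
  assume "complex_vector.dim (UNIV :: 'v set) = 2 \<and> weak_hopf_algebra H"
  then have H: "complex_vector.dim (UNIV :: 'v set) = 2" "weak_hopf_algebra H" by blast+
  then obtain p q X Y where basis: "idempotent_basis H p q X Y"
    using exists_idempotent_basis by blast
  from idempotent_basis.tables_if_weak_hopf_algebra[OF basis H(2)]
  show "weak_hopf_iso H weak_hopf_1 \<or> weak_hopf_iso H weak_hopf_2"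
    using idempotent_basis_iso[OF basis A(1)] idempotent_basis_iso[OF basis A(2)]
      idempotent_basis_iso[OF idempotent_basis.swap[OF basis] A(1)] cyclic_table_1 discrete_table_2
    by blast
qed

end
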